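(* Let $n\ge1$. Consider the inclusions $\mathcal{SB}_n\hookrightarrow\mathrm{Div}(\Delta_n)\hookrightarrow\mathcal{MB}_n\hookrightarrow\mathcal{B}_n$, the canonical projection $\pi:\mathcal{B}_n\to\Sigma_n$ onto the symmetric group, the natural section $s:\Sigma_n\to\mathrm{Div}(\Delta_n)$, the induced maps $$\mathcal{SB}_n/_\sim\to\mathrm{Div}(\Delta_n)/_\sim\to\mathcal{MB}_n/_\sim\to\mathcal{B}_n/_\sim\to\Sigma_n/_\sim$$ on sets of conjugacy classes (the last one induced by $\pi$), and the maps from $\mathcal{SB}_n$, $\mathrm{Div}(\Delta_n)$, $\mathcal{MB}_n$, $\mathcal{B}_n$, $\Sigma_n$ to the corresponding sets of conjugacy classes sending an element to its class. Let $\pi':\mathcal{SB}_n/_\sim\to\Sigma_n/_\sim$ be the composite of the displayed maps. Then these maps form a commutative diagram (all squares formed by the maps to conjugacy classes commute, and $\pi\circ s=\mathrm{id}_{\Sigma_n}$), and both $$s:\Sigma_n\to\mathrm{Div}(\Delta_n)\qquad\text{and}\qquad \pi':\mathcal{SB}_n/_\sim\to\Sigma_n/_\sim$$ are bijections.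
   Context: $\mathcal{B}_n$ is Artin's braid group on $n$ strands, generated by $x_1,\dots,x_{n-1}$ with relations $x_ix_j=x_jx_i$ if $|i-j|\ge2$, $x_{i+1}x_ix_{i+1}=x_ix_{i+1}x_i$; $\mathcal{MB}_n\subset\mathcal{B}_n$ is the monoid of positive braids. The Garside braid is $\Delta_n=x_1(x_2x_1)\cdots(x_{n-1}x_{n-2}\cdots x_1)$ and $\mathrm{Div}(\Delta_n)=\{\alpha\in\mathcal{MB}_n:\Delta_n=\delta\alpha\varepsilon\text{ for some }\delta,\varepsilon\in\mathcal{MB}_n\}$, which is also the set of square free positive braids. $\mathcal{SB}_n$ is the set of simple braids: positive braids represented by a word $x_{i_1}\cdots x_{i_k}$ with pairwise distinct indices. $\pi:\mathcal{B}_n\to\Sigma_n$ is the homomorphism sending $x_i$ to the transposition $(i\ i+1)$. The natural section $s$ sends a permutation with a minimal-length expression as a product of adjacent transpositions $(i_1\ i_1{+}1)\cdots(i_k\ i_k{+}1)$ to the positive braid $x_{i_1}\cdots x_{i_k}$ (independent of the choice of minimal-length expression). For a subset $A\subset\mathcal{B}_n$, $A/_\sim$ denotes the set of conjugacy classes of $\mathcal{B}_n$ that intersect $A$; $\Sigma_n/_\sim$ is the set of conjugacy classes of $\Sigma_n$. *)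

theory Defs
  imports "HOL-Algebra.Sym_Groups" "HOL-Algebra.Group_Action"
begin

text \<open>The letter \<open>(i, True)\<close> stands for \<open>x\<^sub>i\<close> and \<open>(i, False)\<close> for its inverse.\<close>

type_synonym braid_word = "(nat \<times> bool) list"

definition braid_words :: "nat \<Rightarrow> braid_word set" where
  "braid_words n = lists ({1..<n} \<times> UNIV)"

inductive_set braid_cong :: "nat \<Rightarrow> (braid_word \<times> braid_word) set" for n :: nat where
  refl: "w \<in> braid_words n \<Longrightarrow> (w, w) \<in> braid_cong n"
| sym: "(u, v) \<in> braid_cong n \<Longrightarrow> (v, u) \<in> braid_cong n"
| trans: "(u, v) \<in> braid_cong n \<Longrightarrow> (v, w) \<in> braid_cong n \<Longrightarrow> (u, w) \<in> braid_cong n"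
| ctxt: "(u, v) \<in> braid_cong n \<Longrightarrow> a \<in> braid_words n \<Longrightarrow> b \<in> braid_words n \<Longrightarrow>
    (a @ u @ b, a @ v @ b) \<in> braid_cong n"
| cancel: "i \<in> {1..<n} \<Longrightarrow> ([(i, e), (i, \<not> e)], []) \<in> braid_cong n"
| commute: "i \<in> {1..<n} \<Longrightarrow> j \<in> {1..<n} \<Longrightarrow> i + 2 \<le> j \<or> j + 2 \<le> i \<Longrightarrow>
    ([(i, True), (j, True)], [(j, True), (i, True)]) \<in> braid_cong n"
| braid: "i \<in> {1..<n} \<Longrightarrow> Suc i \<in> {1..<n} \<Longrightarrow>
    ([(Suc i, True), (i, True), (Suc i, True)], [(i, True), (Suc i, True), (i, True)])
      \<in> braid_cong n"

definition braid_group :: "nat \<Rightarrow> braid_word set monoid" where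
  "braid_group n =
    \<lparr> carrier = braid_words n // braid_cong n,
      mult = (\<lambda>A B. \<Union>u\<in>A. \<Union>v\<in>B. braid_cong n `` {u @ v}),
      one = braid_cong n `` {[]} \<rparr>"

definition braid_gen :: "nat \<Rightarrow> nat \<Rightarrow> braid_word set" where
  "braid_gen n i = braid_cong n `` {[(i, True)]}"

definition word_prod :: "('a, 'b) monoid_scheme \<Rightarrow> (nat \<Rightarrow> 'a) \<Rightarrow> nat list \<Rightarrow> 'a" where
  "word_prod G x w = foldr (\<otimes>\<^bsub>G\<^esub>) (map x w) \<one>\<^bsub>G\<^esub>"

definition positive_braids :: "nat \<Rightarrow> braid_word set set" where
  "positive_braids n = word_prod (braid_group n) (braid_gen n) ` lists {1..<n}"

definition garside_braid :: "nat \<Rightarrow> braid_word set" where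
  "garside_braid n =
    word_prod (braid_group n) (braid_gen n) (concat (map (\<lambda>k. rev [1..<Suc k]) [1..<n]))"

definition garside_divisors :: "nat \<Rightarrow> braid_word set set" where
  "garside_divisors n =
    {\<alpha> \<in> positive_braids n. \<exists>\<delta>\<in>positive_braids n. \<exists>\<epsilon>\<in>positive_braids n.
       garside_braid n = \<delta> \<otimes>\<^bsub>braid_group n\<^esub> \<alpha> \<otimes>\<^bsub>braid_group n\<^esub> \<epsilon>}"

definition simple_braids :: "nat \<Rightarrow> braid_word set set" where
  "simple_braids n =
    word_prod (braid_group n) (braid_gen n) ` {w \<in> lists {1..<n}. distinct w}"

definition adj_transp :: "nat \<Rightarrow> nat \<Rightarrow> nat" where
  "adj_transp i = transpose i (Suc i)"

definition word_perm :: "braid_word \<Rightarrow> nat \<Rightarrow> nat" where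
  "word_perm w = foldr (\<circ>) (map (adj_transp \<circ> fst) w) id"

text \<open>All words in a braid have the same permutation; see \<open>braid_perm_class\<close> below.\<close>

definition braid_perm :: "braid_word set \<Rightarrow> nat \<Rightarrow> nat" where
  "braid_perm A = the_elem (word_perm ` A)"

definition minimal_expression :: "nat \<Rightarrow> (nat \<Rightarrow> nat) \<Rightarrow> nat list \<Rightarrow> bool" where
  "minimal_expression n p w \<longleftrightarrow>
    w \<in> lists {1..<n} \<and> word_prod (sym_group n) adj_transp w = p \<and>
    (\<forall>v\<in>lists {1..<n}. word_prod (sym_group n) adj_transp v = p \<longrightarrow> length w \<le> length v)"

text \<open>The braid of a minimal expression depends only on the permutation (Matsumoto), so the
  description below is definite for every permutation of \<open>{1..n}\<close>.\<close>

definition perm_braid :: "nat \<Rightarrow> (nat \<Rightarrow> nat) \<Rightarrow> braid_word set" where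
  "perm_braid n p =
    (THE \<beta>. \<exists>w. minimal_expression n p w \<and> \<beta> = word_prod (braid_group n) (braid_gen n) w)"

definition conj_act :: "('a, 'b) monoid_scheme \<Rightarrow> 'a \<Rightarrow> 'a \<Rightarrow> 'a" where
  "conj_act G g = (\<lambda>h\<in>carrier G. g \<otimes>\<^bsub>G\<^esub> h \<otimes>\<^bsub>G\<^esub> inv\<^bsub>G\<^esub> g)"

definition conj_class :: "('a, 'b) monoid_scheme \<Rightarrow> 'a \<Rightarrow> 'a set" where
  "conj_class G = orbit G (conj_act G)"

definition conj_classes_meeting :: "('a, 'b) monoid_scheme \<Rightarrow> 'a set \<Rightarrow> 'a set set" where
  "conj_classes_meeting G A = {C \<in> orbits G (carrier G) (conj_act G). C \<inter> A \<noteq> {}}"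

text \<open>The class of \<open>a \<in> A\<close> goes to the class of \<open>f a\<close>. This is meaningful only if
  conjugate elements of \<open>A\<close> have images conjugate in \<open>H\<close>.\<close>

definition induced_map :: "('b, 'c) monoid_scheme \<Rightarrow> 'a set \<Rightarrow> ('a \<Rightarrow> 'b) \<Rightarrow> 'a set \<Rightarrow> 'b set" where
  "induced_map H A f C = (THE D. \<exists>a\<in>A \<inter> C. D = conj_class H (f a))"

definition simple_to_div :: "nat \<Rightarrow> braid_word set set \<Rightarrow> braid_word set set" where
  "simple_to_div n = induced_map (braid_group n) (simple_braids n) id"

definition div_to_positive :: "nat \<Rightarrow> braid_word set set \<Rightarrow> braid_word set set" where
  "div_to_positive n = induced_map (braid_group n) (garside_divisors n) id"

definition positive_to_braid :: "nat \<Rightarrow> braid_word set set \<Rightarrow> braid_word set set" where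
  "positive_to_braid n = induced_map (braid_group n) (positive_braids n) id"

definition braid_to_perm :: "nat \<Rightarrow> braid_word set set \<Rightarrow> (nat \<Rightarrow> nat) set" where
  "braid_to_perm n = induced_map (sym_group n) (carrier (braid_group n)) braid_perm"

definition simple_to_perm :: "nat \<Rightarrow> braid_word set set \<Rightarrow> (nat \<Rightarrow> nat) set" where
  "simple_to_perm n =
    braid_to_perm n \<circ> positive_to_braid n \<circ> div_to_positive n \<circ> simple_to_div n"

lemma braid_words_append: "u @ v \<in> braid_words n \<longleftrightarrow> u \<in> braid_words n \<and> v \<in> braid_words n"
  by (auto simp: braid_words_def)

lemma braid_cong_words:
  "(u, v) \<in> braid_cong n \<Longrightarrow> u \<in> braid_words n \<and> v \<in> braid_words n"
  by (induction rule: braid_cong.induct) (auto simp: braid_words_def)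

lemma equiv_braid_cong: "equiv (braid_words n) (braid_cong n)"
proof (rule equivI)
  show "braid_cong n \<subseteq> braid_words n \<times> braid_words n" by (auto dest: braid_cong_words)
  show "refl_on (braid_words n) (braid_cong n)" by (rule refl_onI) (rule braid_cong.refl)
  show "sym (braid_cong n)" by (rule symI) (rule braid_cong.sym)
  show "trans (braid_cong n)" by (rule transI) (rule braid_cong.trans)
qed

lemma braid_cong_append:
  assumes "(u, u') \<in> braid_cong n" "(v, v') \<in> braid_cong n"
  shows "(u @ v, u' @ v') \<in> braid_cong n"
proof -
  have w: "u' \<in> braid_words n" "v \<in> braid_words n" "[] \<in> braid_words n"
    using assms[THEN braid_cong_words] by (simp_all add: braid_words_def)
  from braid_cong.ctxt[OF assms(1) w(3) w(2)] braid_cong.ctxt[OF assms(2) w(1) w(3)]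
  show ?thesis by simp (rule braid_cong.trans)
qed

lemma braid_mult_class:
  assumes "u \<in> braid_words n" "v \<in> braid_words n"
  shows "braid_cong n `` {u} \<otimes>\<^bsub>braid_group n\<^esub> braid_cong n `` {v} = braid_cong n `` {u @ v}"
proof -
  have "congruent2 (braid_cong n) (braid_cong n) (\<lambda>u v. braid_cong n `` {u @ v})"
    by (intro congruent2I') (rule equiv_class_eq[OF equiv_braid_cong braid_cong_append])
  from UN_equiv_class2[OF equiv_braid_cong equiv_braid_cong this assms]
  show ?thesis by (simp add: braid_group_def)
qed

lemma braid_group_carrierE:
  assumes "A \<in> carrier (braid_group n)"
  obtains w where "w \<in> braid_words n" "A = braid_cong n `` {w}"
  using assms by (auto simp: braid_group_def elim: quotientE)

lemma braid_class_closed: "w \<in> braid_words n \<Longrightarrow> braid_cong n `` {w} \<in> carrier (braid_group n)"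
  by (auto simp: braid_group_def intro: quotientI)

lemma Nil_braid_words [simp]: "[] \<in> braid_words n"
  by (simp add: braid_words_def)

lemma braid_word_inverse:
  "w \<in> braid_words n \<Longrightarrow> \<exists>v\<in>braid_words n. (v @ w, []) \<in> braid_cong n"
proof (induction w)
  case Nil
  then show ?case by (auto intro!: bexI[of _ "[]"] braid_cong.refl)
next
  case (Cons a w)
  obtain i e where a: "a = (i, e)" by force
  from Cons.prems have i: "i \<in> {1..<n}" and w: "w \<in> braid_words n"
    by (auto simp: a braid_words_def)
  obtain v where v: "v \<in> braid_words n" "(v @ w, []) \<in> braid_cong n" using Cons.IH[OF w] by blast
  have "([(i, \<not> e), (i, e)], []) \<in> braid_cong n"
    using braid_cong.cancel[OF i, of "\<not> e"] by simp
  from braid_cong.ctxt[OF this v(1) w] v(2)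
  have "((v @ [(i, \<not> e)]) @ a # w, []) \<in> braid_cong n"
    by (simp add: a) (rule braid_cong.trans)
  moreover have "v @ [(i, \<not> e)] \<in> braid_words n" using v i by (auto simp: braid_words_def)
  ultimately show ?case by blast
qed

theorem group_braid_group: "group (braid_group n)"
proof (rule groupI)
  fix A B assume "A \<in> carrier (braid_group n)" "B \<in> carrier (braid_group n)"
  then show "A \<otimes>\<^bsub>braid_group n\<^esub> B \<in> carrier (braid_group n)"
    by (elim braid_group_carrierE)
       (simp add: braid_mult_class braid_class_closed braid_words_append)
next
  show "\<one>\<^bsub>braid_group n\<^esub> \<in> carrier (braid_group n)"
    using braid_class_closed[of "[]" n] by (simp add: braid_group_def)
next
  fix A B C
  assume "A \<in> carrier (braid_group n)" "B \<in> carrier (braid_group n)" "C \<in> carrier (braid_group n)"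
  then show "A \<otimes>\<^bsub>braid_group n\<^esub> B \<otimes>\<^bsub>braid_group n\<^esub> C
      = A \<otimes>\<^bsub>braid_group n\<^esub> (B \<otimes>\<^bsub>braid_group n\<^esub> C)"
    by (elim braid_group_carrierE) (simp add: braid_mult_class braid_words_append)
next
  have one: "\<one>\<^bsub>braid_group n\<^esub> = braid_cong n `` {[]}" by (simp add: braid_group_def)
  fix A assume A: "A \<in> carrier (braid_group n)"
  then obtain w where w: "w \<in> braid_words n" "A = braid_cong n `` {w}"
    by (elim braid_group_carrierE)
  then show "\<one>\<^bsub>braid_group n\<^esub> \<otimes>\<^bsub>braid_group n\<^esub> A = A"
    by (simp add: one braid_mult_class)
  obtain v where v: "v \<in> braid_words n" "(v @ w, []) \<in> braid_cong n"
    using braid_word_inverse[OF w(1)] by blast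
  then have "braid_cong n `` {v} \<otimes>\<^bsub>braid_group n\<^esub> A = \<one>\<^bsub>braid_group n\<^esub>"
    using equiv_class_eq[OF equiv_braid_cong] by (simp add: one w braid_mult_class)
  with v(1) show "\<exists>B\<in>carrier (braid_group n). B \<otimes>\<^bsub>braid_group n\<^esub> A = \<one>\<^bsub>braid_group n\<^esub>"
    using braid_class_closed by blast
qed

lemma word_perm_append: "word_perm (u @ v) = word_perm u \<circ> word_perm v"
  by (induction u) (auto simp: word_perm_def comp_assoc)

lemma word_perm_cong: "(u, v) \<in> braid_cong n \<Longrightarrow> word_perm u = word_perm v"
proof (induction rule: braid_cong.induct)
  case (ctxt u v a b)
  then show ?case by (simp add: word_perm_append)
next
  case (commute i j)
  then show ?case
    by (auto simp: word_perm_def adj_transp_def transpose_def fun_eq_iff)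
next
  case (braid i)
  then show ?case
    by (auto simp: word_perm_def adj_transp_def transpose_def fun_eq_iff)
qed (auto simp: word_perm_def adj_transp_def)

lemma braid_perm_class:
  assumes "w \<in> braid_words n"
  shows "braid_perm (braid_cong n `` {w}) = word_perm w"
proof -
  have "word_perm ` (braid_cong n `` {w}) = {word_perm w}"
    using word_perm_cong braid_cong.refl[OF assms] by fastforce
  then show ?thesis by (simp add: braid_perm_def)
qed

lemma word_perm_permutes: "w \<in> braid_words n \<Longrightarrow> word_perm w permutes {1..n}"
proof (induction w)
  case (Cons a w)
  then have "adj_transp (fst a) permutes {1..n}"
    unfolding adj_transp_def by (intro permutes_swap_id) (auto simp: braid_words_def)
  moreover have "word_perm w permutes {1..n}"
    using Cons by (auto simp: braid_words_def)
  ultimately have "adj_transp (fst a) \<circ> word_perm w permutes {1..n}"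
    by (metis permutes_compose)
  then show ?case by (simp add: word_perm_def comp_def)
qed (simp add: word_perm_def permutes_id)

theorem braid_perm_hom: "braid_perm \<in> hom (braid_group n) (sym_group n)"
  by (rule homI; elim braid_group_carrierE)
     (simp_all only: braid_mult_class braid_perm_class braid_words_append word_perm_append
        word_perm_permutes sym_group_carrier sym_group_mult simp_thms)

theorem braid_perm_gen: "i \<in> {1..<n} \<Longrightarrow> braid_perm (braid_gen n i) = transpose i (Suc i)"
  by (simp add: braid_gen_def braid_perm_class braid_words_def word_perm_def adj_transp_def)

end

theory Submission
  imports Defs
begin

text \<open>
  Permutations are measured by their number of inversions, and a word is reduced if its length
  equals the number of inversions of its permutation. By Matsumoto's theorem a reduced word is
  determined, as a braid, by its permutation. The exponent sum of a braid word is an invariant of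
  the braid, and the Garside word is a reduced word of the order-reversing permutation, so if
  \<open>\<Delta> = \<delta>\<alpha>\<epsilon>\<close> with positive factors then any word for \<open>\<delta>\<alpha>\<epsilon>\<close> is reduced, and so is its
  factor \<open>\<alpha>\<close>. Conversely every reduced word extends to one of the order-reversing permutation.
  Hence the divisors of \<open>\<Delta>\<close> are exactly the braids of reduced words.

  A simple braid is conjugate to the increasing word on its set \<open>S\<close> of letters, whose permutation
  cycles through the maximal runs of consecutive strands joined by \<open>S\<close>. If \<open>g\<close> conjugates one such
  permutation to another, it may be rotated along each cycle until it maps first strands to first
  strands. The new \<open>h\<close> then satisfies \<open>h (i + 1) = h i + 1\<close> for all \<open>i \<in> S\<close>, and
  Matsumoto's theorem gives \<open>s(h) x\<^sub>i = x\<^bsub>h(i)\<^esub> s(h)\<close>: the two simple braids are conjugate.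
\<close>

declare One_nat_def [simp del]

subsection \<open>Conjugacy classes\<close>

text \<open>The equation \<open>g \<otimes> a = b \<otimes> g\<close> keeps inverses out of later
  statements, so that conjugacy of two positive braids can be checked as an identity between
  positive words.\<close>

lemma (in group) mem_conj_class_iff:
  assumes "a \<in> carrier G"
  shows "b \<in> conj_class G a \<longleftrightarrow> b \<in> carrier G \<and> (\<exists>g\<in>carrier G. g \<otimes> a = b \<otimes> g)"
proof -
  have "b = g \<otimes> a \<otimes> inv g \<longleftrightarrow> b \<in> carrier G \<and> g \<otimes> a = b \<otimes> g" if "g \<in> carrier G" for g
    using assms that inv_solve_right[of b "g \<otimes> a" g] by (cases "b \<in> carrier G") auto
  then show ?thesis
    using assms by (auto simp: conj_class_def orbit_def conj_act_def)
qed

lemma (in group) conj_class_self: "a \<in> carrier G \<Longrightarrow> a \<in> conj_class G a"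
  using mem_conj_class_iff[of a a] by force

lemma (in group) conj_class_mono:
  assumes "a \<in> carrier G" "b \<in> carrier G" "g \<in> carrier G" "g \<otimes> a = b \<otimes> g"
  shows "conj_class G b \<subseteq> conj_class G a"
proof
  fix c assume "c \<in> conj_class G b"
  then obtain h where h: "h \<in> carrier G" "c \<in> carrier G" "h \<otimes> b = c \<otimes> h"
    using assms by (auto simp: mem_conj_class_iff)
  have "(h \<otimes> g) \<otimes> a = h \<otimes> (b \<otimes> g)" using assms h by (simp add: m_assoc)
  also have "\<dots> = c \<otimes> (h \<otimes> g)" using assms h by (simp flip: m_assoc)
  finally show "c \<in> conj_class G a" using assms h by (auto simp: mem_conj_class_iff)
qed

lemma (in group) conj_class_eqI:
  assumes "a \<in> carrier G" "b \<in> carrier G" "g \<in> carrier G" "g \<otimes> a = b \<otimes> g"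
  shows "conj_class G a = conj_class G b"
proof
  have "inv g \<otimes> b = inv g \<otimes> (b \<otimes> g) \<otimes> inv g" using assms(1-3) by (simp add: m_assoc)
  also have "\<dots> = inv g \<otimes> (g \<otimes> a) \<otimes> inv g" by (simp only: assms(4))
  also have "inv g \<otimes> (g \<otimes> a) = a" using assms(1-3) by (simp flip: m_assoc)
  finally have "inv g \<otimes> b = a \<otimes> inv g" .
  then show "conj_class G a \<subseteq> conj_class G b" using assms by (intro conj_class_mono) auto
  show "conj_class G b \<subseteq> conj_class G a" using assms by (rule conj_class_mono)
qed

lemma (in group) conj_class_eqE:
  assumes "conj_class G a = conj_class G b" "a \<in> carrier G" "b \<in> carrier G"
  obtains g where "g \<in> carrier G" "g \<otimes> a = b \<otimes> g"
  using assms conj_class_self[of b] mem_conj_class_iff[of a b] by blast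

text \<open>A class that meets \<open>A\<close> is the class of any element of the intersection, so
  maps on such classes can be evaluated at representatives in \<open>A\<close>.\<close>

lemma (in group) conj_classes_meeting_eq:
  assumes "A \<subseteq> carrier G"
  shows "conj_classes_meeting G A = conj_class G ` A"
proof -
  have orbits: "orbits G (carrier G) (conj_act G) = conj_class G ` carrier G"
    by (auto simp: orbits_def conj_class_def)
  show ?thesis
  proof (intro equalityI subsetI)
    fix C assume "C \<in> conj_classes_meeting G A"
    then obtain x a where x: "x \<in> carrier G" "C = conj_class G x" and a: "a \<in> A" "a \<in> conj_class G x"
      unfolding conj_classes_meeting_def orbits by blast
    have "C = conj_class G a"
      using x a mem_conj_class_iff[of x a] conj_class_eqI[of x a] by blast
    with a show "C \<in> conj_class G ` A" by blast
  next
    fix C assume "C \<in> conj_class G ` A"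
    then show "C \<in> conj_classes_meeting G A"
      unfolding conj_classes_meeting_def orbits using assms conj_class_self by blast
  qed
qed

text \<open>The description in \<open>induced_map\<close> is definite: a representative in
  \<open>A\<close> exists, and any other one has the same class, hence by \<open>resp\<close> an
  image in the same class of \<open>H\<close>.\<close>

lemma induced_map_class:
  assumes "group G" "A \<subseteq> carrier G" "a \<in> A"
    and resp: "\<And>b. b \<in> A \<Longrightarrow> conj_class G a = conj_class G b \<Longrightarrow> conj_class H (f a) = conj_class H (f b)"
  shows "induced_map H A f (conj_class G a) = conj_class H (f a)"
proof -
  interpret group G by fact
  have "conj_class G a = conj_class G b" if "b \<in> A \<inter> conj_class G a" for b
    using that assms(2,3) conj_class_eqI[of a b] mem_conj_class_iff[of a b] by blast
  then show ?thesis unfolding induced_map_def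
    using resp assms(2,3) conj_class_self by (intro the_equality) blast+
qed

lemma hom_conj_class_eq:
  assumes "group G" "group H" "f \<in> hom G H" "a \<in> carrier G" "b \<in> carrier G"
    and "conj_class G a = conj_class G b"
  shows "conj_class H (f a) = conj_class H (f b)"
proof -
  obtain g where "g \<in> carrier G" "g \<otimes>\<^bsub>G\<^esub> a = b \<otimes>\<^bsub>G\<^esub> g"
    using group.conj_class_eqE assms by metis
  then have "f g \<otimes>\<^bsub>H\<^esub> f a = f b \<otimes>\<^bsub>H\<^esub> f g"
    using assms by (metis hom_mult)
  with \<open>g \<in> carrier G\<close> assms show ?thesis
    by (intro group.conj_class_eqI[of H _ _ "f g"]) (auto simp: hom_in_carrier)
qed

subsection \<open>Positive braid words and their permutations\<close>

abbreviation positive_braid :: "nat \<Rightarrow> nat list \<Rightarrow> braid_word set" where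
  "positive_braid n \<equiv> word_prod (braid_group n) (braid_gen n)"

abbreviation gens :: "nat \<Rightarrow> nat set" where
  "gens n \<equiv> {1..<n}"

text \<open>Both claims go through one induction because \<open>braid_mult_class\<close> multiplies
  classes only of words known to lie in \<open>braid_words n\<close>.\<close>

lemma positive_braid_class:
  "set w \<subseteq> gens n \<Longrightarrow> positive_braid n w = braid_cong n `` {map (\<lambda>i. (i, True)) w}
     \<and> map (\<lambda>i. (i, True)) w \<in> braid_words n"
proof (induction w)
  case Nil
  then show ?case by (simp add: word_prod_def braid_group_def)
next
  case (Cons i w)
  then have "[(i, True)] \<in> braid_words n" "map (\<lambda>i. (i, True)) w \<in> braid_words n"
    by (auto simp: braid_words_def)
  with Cons show ?case
    using braid_words_append[of "[(i, True)]" "map (\<lambda>i. (i, True)) w" n]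
    by (simp add: word_prod_def braid_gen_def braid_mult_class)
qed

lemma positive_braid_closed: "set w \<subseteq> gens n \<Longrightarrow> positive_braid n w \<in> carrier (braid_group n)"
  using positive_braid_class braid_class_closed by metis

lemma positive_braid_append:
  assumes "set u \<subseteq> gens n" "set v \<subseteq> gens n"
  shows "positive_braid n (u @ v) = positive_braid n u \<otimes>\<^bsub>braid_group n\<^esub> positive_braid n v"
  using assms positive_braid_class[of u n] positive_braid_class[of v n]
    positive_braid_class[of "u @ v" n] by (simp add: braid_mult_class)

lemma positive_braid_eqI:
  assumes "set u \<subseteq> gens n" "set v \<subseteq> gens n"
    and "(map (\<lambda>i. (i, True)) u, map (\<lambda>i. (i, True)) v) \<in> braid_cong n"
  shows "positive_braid n u = positive_braid n v"
  using assms positive_braid_class equiv_class_eq[OF equiv_braid_cong] by metis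

lemma positive_braid_commute:
  assumes "i \<in> gens n" "j \<in> gens n" "i + 2 \<le> j \<or> j + 2 \<le> i"
  shows "positive_braid n [i, j] = positive_braid n [j, i]"
  using assms braid_cong.commute[OF assms] by (intro positive_braid_eqI) auto

lemma positive_braid_braid:
  assumes "i \<in> gens n" "Suc i \<in> gens n"
  shows "positive_braid n [Suc i, i, Suc i] = positive_braid n [i, Suc i, i]"
  using assms braid_cong.braid[OF assms] by (intro positive_braid_eqI) auto

lemma positive_braid_eq_append_right:
  assumes "positive_braid n u = positive_braid n v" "set u \<subseteq> gens n" "set v \<subseteq> gens n" "set w \<subseteq> gens n"
  shows "positive_braid n (u @ w) = positive_braid n (v @ w)"
  using assms by (simp add: positive_braid_append)

lemma positive_braid_eq_append_left:
  assumes "positive_braid n u = positive_braid n v" "set u \<subseteq> gens n" "set v \<subseteq> gens n" "set w \<subseteq> gens n"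
  shows "positive_braid n (w @ u) = positive_braid n (w @ v)"
  using assms by (simp add: positive_braid_append)

section \<open>Two invariants of positive words: length and permutation\<close>

definition exponent_sum :: "braid_word \<Rightarrow> int" where
  "exponent_sum w = (\<Sum>(i, e)\<leftarrow>w. if e then 1 else - 1)"

lemma exponent_sum_cong: "(u, v) \<in> braid_cong n \<Longrightarrow> exponent_sum u = exponent_sum v"
  by (induction rule: braid_cong.induct) (auto simp: exponent_sum_def)

text \<open>The last letter acts first, so appending \<open>i\<close> to a word exchanges the values
  of its permutation at the places \<open>i\<close> and \<open>i + 1\<close>.\<close>

definition perm_of :: "nat list \<Rightarrow> nat \<Rightarrow> nat" where
  "perm_of w = foldr (\<circ>) (map adj_transp w) id"

lemma perm_of_simps [simp]:
  "perm_of [] = id" "perm_of (i # w) = adj_transp i \<circ> perm_of w"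
  by (simp_all add: perm_of_def)

lemma perm_of_append [simp]: "perm_of (u @ v) = perm_of u \<circ> perm_of v"
  by (induction u) (simp_all add: comp_assoc)

lemma word_prod_sym: "word_prod (sym_group n) adj_transp w = perm_of w"
  by (simp add: word_prod_def perm_of_def sym_group_def)

lemma perm_of_eq_word_perm: "perm_of w = word_perm (map (\<lambda>i. (i, True)) w)"
  by (simp add: perm_of_def word_perm_def comp_def)

lemma braid_perm_positive_braid: "set w \<subseteq> gens n \<Longrightarrow> braid_perm (positive_braid n w) = perm_of w"
  using positive_braid_class braid_perm_class perm_of_eq_word_perm by metis

lemma perm_of_permutes: "set w \<subseteq> gens n \<Longrightarrow> perm_of w permutes {1..n}"
  using positive_braid_class word_perm_permutes perm_of_eq_word_perm by metis

text \<open>On positive words the exponent sum is the length, and every defining relation preserves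
  the exponent sum.\<close>

lemma length_eq_of_positive_braid_eq:
  assumes "positive_braid n u = positive_braid n v" "set u \<subseteq> gens n" "set v \<subseteq> gens n"
  shows "length u = length v"
proof -
  have "(map (\<lambda>i. (i, True)) u, map (\<lambda>i. (i, True)) v) \<in> braid_cong n"
    using assms positive_braid_class equiv_braid_cong by (metis eq_equiv_class)
  moreover have "exponent_sum (map (\<lambda>i. (i, True)) w) = int (length w)" for w
    by (induction w) (auto simp: exponent_sum_def)
  ultimately show ?thesis using exponent_sum_cong by fastforce
qed

lemma adj_transp_simps [simp]:
  "adj_transp i i = Suc i" "adj_transp i (Suc i) = i"
  "j \<noteq> i \<Longrightarrow> j \<noteq> Suc i \<Longrightarrow> adj_transp i j = j"
  by (auto simp: adj_transp_def)

lemma adj_transp_involutive [simp]: "adj_transp i (adj_transp i j) = j"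
  by (simp add: adj_transp_def)

lemma comp_adj_transp_involutive [simp]: "p \<circ> adj_transp i \<circ> adj_transp i = p"
  by (simp add: fun_eq_iff)

lemma adj_transp_permutes: "i \<in> gens n \<Longrightarrow> adj_transp i permutes {1..n}"
  by (auto simp: adj_transp_def intro!: permutes_swap_id)

lemma comp_adj_transp_permutes:
  "p permutes {1..n} \<Longrightarrow> i \<in> gens n \<Longrightarrow> p \<circ> adj_transp i permutes {1..n}"
  using adj_transp_permutes permutes_compose by blast

definition inversions :: "(nat \<Rightarrow> nat) \<Rightarrow> (nat \<times> nat) set" where
  "inversions p = {(a, b). a < b \<and> p b < p a}"

definition perm_length :: "(nat \<Rightarrow> nat) \<Rightarrow> nat" where
  "perm_length p = card (inversions p)"

lemma permutes_le_iff: "p permutes {1..n} \<Longrightarrow> p i \<le> n \<longleftrightarrow> i \<le> (n::nat)"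
  by (cases "i = 0") (use permutes_in_image[of p "{1..n}" i] permutes_not_in[of p "{1..n}" i] in auto)

subsection \<open>Inversions and reduced words\<close>

definition index_pairs :: "nat \<Rightarrow> (nat \<times> nat) set" where
  "index_pairs n = {(a, b). 1 \<le> a \<and> a < b \<and> b \<le> n}"

lemma finite_index_pairs: "finite (index_pairs n)"
  by (rule finite_subset[of _ "{..n} \<times> {..n}"]) (auto simp: index_pairs_def)

lemma inversions_subset:
  assumes "p permutes {1..n}"
  shows "inversions p \<subseteq> index_pairs n"
proof (clarsimp simp: inversions_def index_pairs_def)
  fix a b assume ab: "a < b" "p b < p a"
  have "a \<noteq> 0" using ab permutes_not_in[OF assms, of 0] by (cases a) auto
  moreover have "b \<le> n"
  proof (rule ccontr)
    assume "\<not> b \<le> n"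
    then have "p b = b" using permutes_not_in[OF assms] by auto
    with ab have "\<not> p a \<le> n" using \<open>\<not> b \<le> n\<close> by simp
    then have "p a = a" using permutes_le_iff[OF assms] permutes_not_in[OF assms] by auto
    with ab \<open>p b = b\<close> show False by simp
  qed
  ultimately show "1 \<le> a \<and> b \<le> n" by simp
qed

lemma finite_inversions: "p permutes {1..n} \<Longrightarrow> finite (inversions p)"
  by (rule finite_subset[OF inversions_subset finite_index_pairs])

text \<open>Exchanging \<open>i\<close> and \<open>i + 1\<close> preserves the order of every pair
  of places except these two. Relabelling therefore carries the inversions of \<open>p\<close> to
  those of the product, and the pair \<open>(i, Suc i)\<close> is the only new one.\<close>

lemma perm_length_ascent:
  assumes "p permutes {1..n}" "p i < p (Suc i)"
  shows "perm_length (p \<circ> adj_transp i) = Suc (perm_length p)"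
proof -
  let ?f = "map_prod (adj_transp i) (adj_transp i)"
  have inv: "?f (?f x) = x" for x by (cases x) simp
  have less: "adj_transp i a < adj_transp i b \<longleftrightarrow> a < b" if "(a, b) \<noteq> (i, Suc i)" "(a, b) \<noteq> (Suc i, i)" for a b
    using that by (auto simp: adj_transp_def transpose_def)
  have mem: "(a, b) \<in> inversions (p \<circ> adj_transp i) \<longleftrightarrow> (a, b) = (i, Suc i) \<or> ?f (a, b) \<in> inversions p" for a b
    using less[of a b] assms(2)
    by (cases "(a, b) = (i, Suc i)"; cases "(a, b) = (Suc i, i)") (auto simp: inversions_def)
  have img: "x \<in> ?f ` inversions p \<longleftrightarrow> ?f x \<in> inversions p" for x
    using inv by (metis imageE imageI)
  have "inversions (p \<circ> adj_transp i) = insert (i, Suc i) (?f ` inversions p)" (is "?A = ?B")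
  proof (rule Set.set_eqI)
    fix x show "x \<in> ?A \<longleftrightarrow> x \<in> ?B"
      by (cases x) (simp only: mem img insert_iff)
  qed
  moreover have "(i, Suc i) \<notin> ?f ` inversions p"
    by (auto simp: inversions_def adj_transp_def transpose_def split: if_splits)
  moreover have "inj_on ?f (inversions p)" by (rule inj_onI) (metis inv)
  ultimately show ?thesis
    using finite_inversions[OF assms(1)] by (simp add: perm_length_def card_image)
qed

lemma perm_length_descent:
  assumes "p permutes {1..n}" "i \<in> gens n" "p (Suc i) < p i"
  shows "perm_length p = Suc (perm_length (p \<circ> adj_transp i))"
  using perm_length_ascent[of "p \<circ> adj_transp i" n i] comp_adj_transp_permutes assms by simp

lemma permutes_ascent_or_descent:
  assumes "p permutes {1..n}"
  shows "p i < p (Suc i) \<or> p (Suc i) < p i"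
  using inj_eq[OF permutes_inj[OF assms], of i "Suc i"] by (simp add: neq_iff)

lemma perm_length_comp_adj_le:
  assumes "p permutes {1..n}" "i \<in> gens n"
  shows "perm_length (p \<circ> adj_transp i) \<le> Suc (perm_length p)"
  using permutes_ascent_or_descent[OF assms(1), of i] perm_length_ascent[OF assms(1), of i]
    perm_length_descent[OF assms] by linarith

lemma perm_length_comp_perm_of_le:
  assumes "p permutes {1..n}" "set w \<subseteq> gens n"
  shows "perm_length (p \<circ> perm_of w) \<le> perm_length p + length w"
  using assms(2)
proof (induction w rule: rev_induct)
  case (snoc i w)
  then have w: "set w \<subseteq> gens n" "i \<in> gens n" by auto
  then have "p \<circ> perm_of w permutes {1..n}"
    by (intro permutes_compose perm_of_permutes assms(1)) auto
  moreover have "p \<circ> perm_of (w @ [i]) = p \<circ> perm_of w \<circ> adj_transp i" by (simp add: comp_assoc)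
  ultimately have "perm_length (p \<circ> perm_of (w @ [i])) \<le> Suc (perm_length (p \<circ> perm_of w))"
    using perm_length_comp_adj_le w by presburger
  then show ?case using snoc.IH[OF w(1)] unfolding length_append_singleton by linarith
qed simp

lemma perm_length_id [simp]: "perm_length id = 0"
proof -
  have "inversions id = {}" by (auto simp: inversions_def)
  then show ?thesis by (simp add: perm_length_def)
qed

lemma perm_length_perm_of_le: "set w \<subseteq> gens n \<Longrightarrow> perm_length (perm_of w) \<le> length w"
  using perm_length_comp_perm_of_le[of id n w] by (simp add: permutes_id)

text \<open>Ascending everywhere, \<open>p\<close> is strictly monotone, and so is its inverse.
  Neither can then lower a point, so \<open>p\<close> fixes every point.\<close>

lemma permutes_without_descent:
  assumes p: "p permutes {1..n}" and asc: "\<And>i. i \<in> gens n \<Longrightarrow> p i < p (Suc i)"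
  shows "p = id"
proof -
  \<comment> \<open>Monotonicity on all naturals also needs the places outside
    \<open>gens n\<close>: \<open>p\<close> fixes 0 and everything above \<open>n\<close>, and maps
    no point up to \<open>n\<close> beyond \<open>n\<close>.\<close>
  have "p i < p (Suc i)" for i
  proof (cases "i \<in> gens n")
    case False
    then consider "i = 0" | "i \<ge> n" by fastforce
    then show ?thesis
    proof cases
      case 1
      then show ?thesis
        using permutes_not_in[OF p, of 0] inj_eq[OF permutes_inj[OF p], of 0 "Suc 0"] by simp
    next
      case 2
      then have "p (Suc i) = Suc i" "p i \<le> i"
        using permutes_not_in[OF p] permutes_le_iff[OF p, of i] by (auto simp: le_less)
      then show ?thesis by simp
    qed
  qed (use asc in auto)
  then have mono: "strict_mono p" by (simp add: strict_mono_Suc_iff)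
  then have "strict_mono (inv_into UNIV p)"
    using strict_mono_less[OF mono] permutes_inverses(1)[OF p] by (metis strict_monoI)
  then have "i \<le> p i" "i \<le> inv_into UNIV p i" for i
    using mono strict_mono_imp_increasing by blast+
  then have "p i = i" for i
    using permutes_inverses(2)[OF p, of i] by (metis le_antisym)
  then show ?thesis by auto
qed

section \<open>Reduced words and Matsumoto's theorem\<close>

definition reduced :: "nat \<Rightarrow> nat list \<Rightarrow> bool" where
  "reduced n w \<longleftrightarrow> set w \<subseteq> gens n \<and> perm_length (perm_of w) = length w"

lemma reduced_snoc_ascent:
  assumes "reduced n w" "i \<in> gens n" "perm_of w i < perm_of w (Suc i)"
  shows "reduced n (w @ [i])"
  using assms perm_length_ascent[OF perm_of_permutes] by (auto simp: reduced_def)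

text \<open>This is bubble sort: removing a descent lowers the number of inversions by one, and only
  the identity has no descent.\<close>

lemma ex_reduced:
  assumes "p permutes {1..n}"
  shows "\<exists>w. reduced n w \<and> perm_of w = p"
  using assms
proof (induction "perm_length p" arbitrary: p rule: less_induct)
  case less
  show ?case
  proof (cases "p = id")
    case True
    then show ?thesis by (intro exI[of _ "[]"]) (simp add: reduced_def)
  next
    case False
    then obtain i where i: "i \<in> gens n" "p (Suc i) < p i"
      using permutes_without_descent[OF less.prems] permutes_ascent_or_descent[OF less.prems] by blast
    obtain w where w: "reduced n w" "perm_of w = p \<circ> adj_transp i"
      using less.hyps[of "p \<circ> adj_transp i"] perm_length_descent[OF less.prems i]
        comp_adj_transp_permutes[OF less.prems i(1)] by auto
    then show ?thesis
      using reduced_snoc_ascent[OF w(1) i(1)] i(2) by (intro exI[of _ "w @ [i]"]) simp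
  qed
qed

lemma reduced_appendD:
  assumes "reduced n (u @ v)"
  shows "reduced n u" "reduced n v"
proof -
  have sets: "set u \<subseteq> gens n" "set v \<subseteq> gens n"
    and len: "perm_length (perm_of u \<circ> perm_of v) = length u + length v"
    using assms by (auto simp: reduced_def)
  show "reduced n u"
    using sets len perm_length_comp_perm_of_le[OF perm_of_permutes, of u n v]
      perm_length_perm_of_le[of u n] by (simp add: reduced_def)
  \<comment> \<open>The length estimates concern multiplication on the right, so the suffix is
    treated by comparison: if \<open>v\<close> were too long, replacing it by a reduced
    \<open>v'\<close> would give a word for the same permutation with fewer letters than
    inversions.\<close>
  obtain v' where v': "reduced n v'" "perm_of v' = perm_of v"
    using ex_reduced perm_of_permutes sets by metis
  have "perm_length (perm_of (u @ v')) \<le> length u + length v'"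
    using perm_length_perm_of_le[of "u @ v'" n] v' sets by (simp add: reduced_def)
  with v' sets len perm_length_perm_of_le[of v n] show "reduced n v"
    by (simp add: reduced_def)
qed

lemma reduced_snocD:
  assumes "reduced n (w @ [i])"
  shows "perm_of (w @ [i]) (Suc i) < perm_of (w @ [i]) i"
proof -
  have w: "reduced n w" "i \<in> gens n"
    using reduced_appendD[OF assms] by (auto simp: reduced_def)
  then have p: "perm_of w permutes {1..n}" by (simp add: reduced_def perm_of_permutes)
  have "\<not> perm_of w (Suc i) < perm_of w i"
    using perm_length_descent[OF p w(2)] w assms by (auto simp: reduced_def)
  then show ?thesis using permutes_ascent_or_descent[OF p, of i] by simp
qed

lemma comp_adj_transp_commute:
  assumes "i + 2 \<le> j"
  shows "p \<circ> adj_transp i \<circ> adj_transp j = p \<circ> adj_transp j \<circ> adj_transp i"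
proof -
  have "adj_transp i \<circ> adj_transp j = adj_transp j \<circ> adj_transp i"
    using assms by (auto simp: fun_eq_iff adj_transp_def transpose_def)
  then show ?thesis by (simp only: comp_assoc)
qed

lemma comp_adj_transp_braid:
  "p \<circ> adj_transp i \<circ> adj_transp (Suc i) \<circ> adj_transp i
    = p \<circ> adj_transp (Suc i) \<circ> adj_transp i \<circ> adj_transp (Suc i)"
proof -
  have "adj_transp i \<circ> (adj_transp (Suc i) \<circ> adj_transp i)
      = adj_transp (Suc i) \<circ> (adj_transp i \<circ> adj_transp (Suc i))"
    by (auto simp: fun_eq_iff adj_transp_def transpose_def)
  then show ?thesis by (simp only: comp_assoc)
qed

lemma reduced_length_eq:
  "reduced n u \<Longrightarrow> reduced n v \<Longrightarrow> perm_of u = perm_of v \<Longrightarrow> length v = length u"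
  by (metis reduced_def)

text \<open>Induction on the length, comparing last letters. If they differ, both are descents of
  \<open>p\<close>, so \<open>p\<close> also has reduced words ending in the two sides of the
  commutation or braid relation between them, after a common prefix \<open>t\<close>. The induction
  hypothesis moves each given word to one of these, and the relation joins them.\<close>

theorem matsumoto:
  assumes "reduced n u" "reduced n v" "perm_of u = perm_of v"
  shows "positive_braid n u = positive_braid n v"
  using assms
proof (induction "length u" arbitrary: u v)
  case 0
  then have "length v = length u" using reduced_length_eq by blast
  with 0 show ?case by simp
next
  case (Suc l)
  define p where "p = perm_of u"
  have p: "p permutes {1..n}" using Suc.prems by (simp add: p_def reduced_def perm_of_permutes)
  have step: "positive_braid n (u @ [i]) = positive_braid n (v @ [j])"
    if uv: "reduced n (u @ [i])" "reduced n (v @ [j])" "perm_of (u @ [i]) = p" "perm_of (v @ [j]) = p"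
      "length u = l" "i < j" for u v i j
  proof -
    have sets: "i \<in> gens n" "j \<in> gens n" "set u \<subseteq> gens n" "set v \<subseteq> gens n"
      using uv(1,2) by (auto simp: reduced_def)
    have red: "reduced n u" "reduced n v"
      using uv(1,2) reduced_appendD by blast+
    have "perm_of (u @ [i]) \<circ> adj_transp i = perm_of u" "perm_of (v @ [j]) \<circ> adj_transp j = perm_of v"
      by simp_all
    then have perms: "perm_of u = p \<circ> adj_transp i" "perm_of v = p \<circ> adj_transp j"
      unfolding uv(3,4) by simp_all
    have desc: "p (Suc i) < p i" "p (Suc j) < p j"
      using reduced_snocD[OF uv(1)] reduced_snocD[OF uv(2)] unfolding uv(3,4) .
    have lv: "length v = l"
      using reduced_length_eq[OF uv(1,2)] uv(3-5) by simp
    have reduce: "\<exists>w. reduced n w \<and> perm_of w = q" if "q permutes {1..n}" for q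
      using ex_reduced that by blast
    show ?thesis
    proof (cases "j = Suc i")
      case False
      \<comment> \<open>For distant letters the two descents are independent; \<open>q\<close> has
        both removed, and removing them in the other order gives the same permutation.\<close>
      define q where "q = p \<circ> adj_transp i \<circ> adj_transp j"
      have "q permutes {1..n}" unfolding q_def by (intro comp_adj_transp_permutes p sets)
      then obtain t where t: "reduced n t" "perm_of t = q" using reduce by blast
      have q': "q = p \<circ> adj_transp j \<circ> adj_transp i"
        unfolding q_def using False uv(6) by (intro comp_adj_transp_commute) simp
      have "reduced n (t @ [j])"
        using t sets desc False uv(6) by (intro reduced_snoc_ascent) (simp_all add: q_def)
      then have u: "positive_braid n u = positive_braid n (t @ [j])"
        using red t perms uv(5) by (intro Suc.hyps) (simp_all add: q_def)
      have "reduced n (t @ [i])"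
        using t sets desc False uv(6) by (intro reduced_snoc_ascent) (simp_all add: q')
      then have v: "positive_braid n v = positive_braid n (t @ [i])"
        using red t perms lv by (intro Suc.hyps) (simp_all add: q')
      have ts: "set t \<subseteq> gens n" using t by (simp add: reduced_def)
      have "positive_braid n (u @ [i]) = positive_braid n (t @ [j, i])"
        using positive_braid_eq_append_right[OF u, of "[i]"] sets ts by simp
      also have "\<dots> = positive_braid n (t @ [i, j])"
        using sets ts False uv(6) positive_braid_commute[of i n j]
        by (intro positive_braid_eq_append_left) auto
      also have "\<dots> = positive_braid n (v @ [j])"
        using positive_braid_eq_append_right[OF v, of "[j]"] sets ts by simp
      finally show ?thesis .
    next
      case True
      \<comment> \<open>Descents at \<open>i\<close> and \<open>i + 1\<close> mean that
        \<open>p\<close> decreases on the places \<open>i\<close>, \<open>i + 1\<close>,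
        \<open>i + 2\<close>; \<open>q\<close> has these three values in increasing order, so three
        ascents lead back to \<open>p\<close> along either side of the braid relation.\<close>
      define q where "q = p \<circ> adj_transp i \<circ> adj_transp j \<circ> adj_transp i"
      have "q permutes {1..n}" unfolding q_def by (intro comp_adj_transp_permutes p sets)
      then obtain t where t: "reduced n t" "perm_of t = q" using reduce by blast
      have q': "q = p \<circ> adj_transp j \<circ> adj_transp i \<circ> adj_transp j"
        unfolding q_def True by (rule comp_adj_transp_braid)
      have "reduced n (t @ [i])"
        using t sets desc True by (intro reduced_snoc_ascent) (simp_all add: q_def)
      then have "reduced n ((t @ [i]) @ [j])"
        using t sets desc True by (intro reduced_snoc_ascent) (simp_all add: q_def)
      then have u: "positive_braid n u = positive_braid n (t @ [i, j])"
        using red t perms uv(5) by (intro Suc.hyps) (simp_all add: q_def fun_eq_iff)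
      have "reduced n (t @ [j])"
        using t sets desc True by (intro reduced_snoc_ascent) (simp_all add: q')
      then have "reduced n ((t @ [j]) @ [i])"
        using t sets desc True by (intro reduced_snoc_ascent) (simp_all add: q')
      then have v: "positive_braid n v = positive_braid n (t @ [j, i])"
        using red t perms lv by (intro Suc.hyps) (simp_all add: q' fun_eq_iff)
      have ts: "set t \<subseteq> gens n" using t by (simp add: reduced_def)
      have "positive_braid n (u @ [i]) = positive_braid n (t @ [i, j, i])"
        using positive_braid_eq_append_right[OF u, of "[i]"] sets ts by simp
      also have "\<dots> = positive_braid n (t @ [j, i, j])"
        using sets ts True positive_braid_braid[of i n]
        by (intro positive_braid_eq_append_left) auto
      also have "\<dots> = positive_braid n (v @ [j])"
        using positive_braid_eq_append_right[OF v, of "[j]"] sets ts by simp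
      finally show ?thesis .
    qed
  qed
  have lv: "length v = Suc l" using reduced_length_eq[OF Suc.prems] Suc.hyps(2) by simp
  obtain u' i where u: "u = u' @ [i]" using Suc.hyps(2) by (metis length_Suc_conv_rev)
  obtain v' j where v: "v = v' @ [j]" using lv by (metis length_Suc_conv_rev)
  have len: "length u' = l" "length v' = l" using u v lv Suc.hyps(2) by simp_all
  note red = Suc.prems(1)[unfolded u] Suc.prems(2)[unfolded v]
  have perms: "perm_of (u' @ [i]) = p" "perm_of (v' @ [j]) = p"
    using Suc.prems(3) unfolding p_def u v by (simp_all only:)
  consider "i < j" | "j < i" | "i = j" by linarith
  then show ?case
  proof cases
    case 1
    show ?thesis unfolding u v by (rule step[OF red perms len(1) 1])
  next
    case 2
    show ?thesis unfolding u v by (rule step[OF red(2,1) perms(2,1) len(2) 2, THEN HOL.sym])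
  next
    case 3
    have red': "reduced n u'" "reduced n v'" using red reduced_appendD by blast+
    have "perm_of (u' @ [i]) \<circ> adj_transp i = perm_of u'" "perm_of (v' @ [i]) \<circ> adj_transp i = perm_of v'"
      by simp_all
    then have "perm_of u' = perm_of v'" using perms 3 by metis
    then have "positive_braid n u' = positive_braid n v'"
      using Suc.hyps(1) len(1) red' by blast
    then show ?thesis unfolding u v 3
      using red red' 3 by (intro positive_braid_eq_append_right) (auto simp: reduced_def)
  qed
qed

subsection \<open>Divisors of the Garside braid\<close>

lemma perm_of_decreasing_run:
  "perm_of (rev [1..<Suc k]) i = (if i = 1 then Suc k else if 1 < i \<and> i \<le> Suc k then i - 1 else i)"
proof (induction k)
  case (Suc k)
  have "rev [1..<Suc (Suc k)] = Suc k # rev [1..<Suc k]" by simp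
  then have "perm_of (rev [1..<Suc (Suc k)]) i = adj_transp (Suc k) (perm_of (rev [1..<Suc k]) i)"
    by simp
  then show ?case unfolding Suc.IH by (auto simp: adj_transp_def transpose_def)
qed auto

definition garside_word :: "nat \<Rightarrow> nat list" where
  "garside_word n = concat (map (\<lambda>k. rev [1..<Suc k]) [1..<n])"

definition reversal :: "nat \<Rightarrow> nat \<Rightarrow> nat" where
  "reversal n i = (if 1 \<le> i \<and> i \<le> n then Suc n - i else i)"

lemma garside_word_Suc: "garside_word (Suc n) = garside_word n @ rev [1..<Suc n]"
  by (cases n) (simp_all add: garside_word_def)

lemma garside_braid_eq: "garside_braid n = positive_braid n (garside_word n)"
  by (simp only: garside_braid_def garside_word_def)

lemma set_garside_word: "set (garside_word n) \<subseteq> gens n"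
  by (auto simp: garside_word_def)

text \<open>The run added for \<open>Suc n\<close> sends 1 to \<open>Suc n\<close>, which
  \<open>reversal n\<close> fixes, and lowers the other points by one before
  \<open>reversal n\<close> flips them.\<close>

lemma perm_of_garside_word: "perm_of (garside_word n) = reversal n"
proof (induction n)
  case 0
  then show ?case by (auto simp: garside_word_def reversal_def)
next
  case (Suc n)
  have "reversal n (perm_of (rev [1..<Suc n]) i) = reversal (Suc n) i" for i
    unfolding perm_of_decreasing_run by (auto simp: reversal_def)
  then show ?case by (simp only: garside_word_Suc perm_of_append Suc.IH) auto
qed

text \<open>Passing from \<open>n\<close> to \<open>Suc n\<close> adds \<open>n\<close> pairs and a
  run of \<open>n\<close> letters. As \<open>reversal n\<close> inverts every pair, the Garside word
  is reduced and attains the largest possible number of inversions.\<close>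

lemma card_index_pairs: "card (index_pairs n) = length (garside_word n)"
proof (induction n)
  case 0
  then show ?case by (auto simp: index_pairs_def garside_word_def card_eq_0_iff)
next
  case (Suc n)
  have "index_pairs (Suc n) = index_pairs n \<union> {1..n} \<times> {Suc n}"
    by (auto simp: index_pairs_def)
  moreover have "index_pairs n \<inter> {1..n} \<times> {Suc n} = {}" by (auto simp: index_pairs_def)
  ultimately have "card (index_pairs (Suc n)) = card (index_pairs n) + n"
    using finite_index_pairs by (simp add: card_Un_disjoint card_cartesian_product)
  then show ?case using Suc.IH by (simp add: garside_word_Suc)
qed

lemma perm_length_le: "p permutes {1..n} \<Longrightarrow> perm_length p \<le> card (index_pairs n)"
  unfolding perm_length_def by (rule card_mono[OF finite_index_pairs inversions_subset])

lemma inversions_reversal: "inversions (reversal n) = index_pairs n"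
  by (auto simp: inversions_def index_pairs_def reversal_def split: if_splits)

lemma reduced_garside_word: "reduced n (garside_word n)"
  using set_garside_word
  by (simp add: reduced_def perm_length_def perm_of_garside_word inversions_reversal card_index_pairs)

text \<open>Composing with the reversal turns descents into ascents and reduces the claim to
  \<open>permutes_without_descent\<close>.\<close>

lemma permutes_without_ascent:
  assumes p: "p permutes {1..n}" and desc: "\<And>i. i \<in> gens n \<Longrightarrow> p (Suc i) < p i"
  shows "p = reversal n"
proof -
  have r: "reversal n permutes {1..n}"
    using perm_of_permutes[OF set_garside_word] by (simp add: perm_of_garside_word)
  have invol: "reversal n (reversal n i) = i" for i by (auto simp: reversal_def)
  have "reversal n \<circ> p = id"
  proof (rule permutes_without_descent)
    show "reversal n \<circ> p permutes {1..n}" by (rule permutes_compose[OF p r])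
    fix i assume i: "i \<in> gens n"
    then have "p i \<in> {1..n}" "p (Suc i) \<in> {1..n}"
      using permutes_in_image[OF p] by auto
    then show "(reversal n \<circ> p) i < (reversal n \<circ> p) (Suc i)"
      using desc[OF i] by (auto simp: reversal_def)
  qed
  then have "reversal n (reversal n (p i)) = reversal n i" for i by (simp add: fun_eq_iff)
  then show ?thesis by (auto simp: invol)
qed

text \<open>Ascents are appended one after another. The number of inversions is bounded, and the
  process can stop only at a permutation without ascents, the reversal.\<close>

lemma reduced_extends_to_garside:
  assumes "reduced n w"
  shows "\<exists>v. reduced n (w @ v) \<and> perm_of (w @ v) = reversal n"
  using assms
proof (induction "card (index_pairs n) - length w" arbitrary: w rule: less_induct)
  case less
  have p: "perm_of w permutes {1..n}" using less.prems by (simp add: reduced_def perm_of_permutes)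
  show ?case
  proof (cases "perm_of w = reversal n")
    case True
    then show ?thesis using less.prems by (intro exI[of _ "[]"]) simp
  next
    case False
    then obtain i where i: "i \<in> gens n" "perm_of w i < perm_of w (Suc i)"
      using permutes_without_ascent[OF p] permutes_ascent_or_descent[OF p] by blast
    have red: "reduced n (w @ [i])" using reduced_snoc_ascent[OF less.prems i] .
    \<comment> \<open>The subtraction in the induction measure is truncated, so this bound is what
      makes the measure decrease.\<close>
    then have "length (w @ [i]) \<le> card (index_pairs n)"
      using perm_length_le[OF perm_of_permutes] by (metis reduced_def)
    then have "card (index_pairs n) - length (w @ [i]) < card (index_pairs n) - length w" by simp
    from less.hyps[OF this red] obtain v where
      "reduced n ((w @ [i]) @ v)" "perm_of ((w @ [i]) @ v) = reversal n" by blast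
    then show ?thesis by (intro exI[of _ "i # v"]) (simp del: perm_of_append)
  qed
qed

lemma positive_braids_eq: "positive_braids n = positive_braid n ` {w. set w \<subseteq> gens n}"
  by (simp add: positive_braids_def lists_eq_set)

lemma simple_braids_eq: "simple_braids n = positive_braid n ` {w. set w \<subseteq> gens n \<and> distinct w}"
  by (simp add: simple_braids_def lists_eq_set)

theorem garside_divisors_eq: "garside_divisors n = positive_braid n ` {w. reduced n w}"
proof (intro equalityI subsetI)
  fix \<alpha> assume "\<alpha> \<in> garside_divisors n"
  then obtain d a e where words: "set d \<subseteq> gens n" "set a \<subseteq> gens n" "set e \<subseteq> gens n"
    and \<alpha>: "\<alpha> = positive_braid n a"
    and g: "garside_braid n = positive_braid n d \<otimes>\<^bsub>braid_group n\<^esub> \<alpha> \<otimes>\<^bsub>braid_group n\<^esub> positive_braid n e"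
    by (auto simp: garside_divisors_def positive_braids_eq)
  have eq: "positive_braid n (garside_word n) = positive_braid n ((d @ a) @ e)"
    using g words positive_braid_append[of "d @ a" n e] by (simp add: garside_braid_eq \<alpha> positive_braid_append)
  have dae: "set ((d @ a) @ e) \<subseteq> gens n" using words by simp
  have "perm_of ((d @ a) @ e) = perm_of (garside_word n)"
    using eq braid_perm_positive_braid[OF dae] braid_perm_positive_braid[OF set_garside_word] by metis
  moreover have "length ((d @ a) @ e) = length (garside_word n)"
    using length_eq_of_positive_braid_eq[OF eq set_garside_word dae] by simp
  ultimately have "reduced n ((d @ a) @ e)"
    using dae reduced_garside_word by (metis reduced_def)
  then have "reduced n a" using reduced_appendD by blast
  with \<alpha> show "\<alpha> \<in> positive_braid n ` {w. reduced n w}" by blast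
next
  fix \<alpha> assume "\<alpha> \<in> positive_braid n ` {w. reduced n w}"
  then obtain w where w: "reduced n w" "\<alpha> = positive_braid n w" by blast
  then obtain v where v: "reduced n (w @ v)" "perm_of (w @ v) = reversal n"
    using reduced_extends_to_garside by blast
  then have sets: "set w \<subseteq> gens n" "set v \<subseteq> gens n" by (simp_all add: reduced_def)
  \<comment> \<open>The empty word serves as left factor: the braid of a reduced word is even a left
    divisor of \<open>\<Delta>\<close>.\<close>
  have "garside_braid n = positive_braid n (([] @ w) @ v)"
    unfolding garside_braid_eq
    using v perm_of_garside_word by (intro matsumoto reduced_garside_word) simp_all
  also have "\<dots> = positive_braid n [] \<otimes>\<^bsub>braid_group n\<^esub> \<alpha> \<otimes>\<^bsub>braid_group n\<^esub> positive_braid n v"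
    unfolding w(2) using sets positive_braid_append[of "[]" n w] positive_braid_append[of "[] @ w" n v] by simp
  finally have *: "garside_braid n
      = positive_braid n [] \<otimes>\<^bsub>braid_group n\<^esub> \<alpha> \<otimes>\<^bsub>braid_group n\<^esub> positive_braid n v" .
  have "positive_braid n u \<in> positive_braids n" if "set u \<subseteq> gens n" for u
    unfolding positive_braids_eq using that by blast
  from this[of w] this[of v] this[of "[]"]
  have "\<alpha> \<in> positive_braids n" "positive_braid n v \<in> positive_braids n" "positive_braid n [] \<in> positive_braids n"
    using sets w(2) by simp_all
  with * show "\<alpha> \<in> garside_divisors n" unfolding garside_divisors_def by blast
qed

section \<open>The natural section\<close>

lemma minimal_expression_iff: "minimal_expression n p w \<longleftrightarrow> reduced n w \<and> perm_of w = p"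
proof
  assume "minimal_expression n p w"
  then have w: "set w \<subseteq> gens n" "perm_of w = p"
    and min: "\<forall>v\<in>lists (gens n). perm_of v = p \<longrightarrow> length w \<le> length v"
    unfolding minimal_expression_def word_prod_sym lists_eq_set by auto
  obtain v where v: "reduced n v" "perm_of v = p"
    using ex_reduced perm_of_permutes w by metis
  then have "length w \<le> length v" using min unfolding reduced_def lists_eq_set by blast
  then show "reduced n w \<and> perm_of w = p"
    using v w perm_length_perm_of_le[OF w(1)] by (simp add: reduced_def)
next
  assume w: "reduced n w \<and> perm_of w = p"
  then have "length w \<le> length v" if "v \<in> lists (gens n)" "perm_of v = p" for v
  proof -
    have "set v \<subseteq> gens n" using that(1) by (simp add: lists_eq_set)
    from perm_length_perm_of_le[OF this] show ?thesis using w that(2) unfolding reduced_def by metis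
  qed
  with w show "minimal_expression n p w"
    unfolding minimal_expression_def word_prod_sym reduced_def lists_eq_set by blast
qed

text \<open>Matsumoto's theorem makes the description in \<open>perm_braid\<close> definite.\<close>

lemma perm_braid_perm_of:
  assumes "reduced n w"
  shows "perm_braid n (perm_of w) = positive_braid n w"
  unfolding perm_braid_def minimal_expression_iff
  using assms matsumoto by (intro the_equality) blast+

lemma braid_perm_perm_braid:
  assumes "p permutes {1..n}"
  shows "braid_perm (perm_braid n p) = p"
proof -
  obtain w where "reduced n w" "perm_of w = p" using ex_reduced[OF assms] by blast
  then show ?thesis
    using perm_braid_perm_of[of n w] by (simp add: braid_perm_positive_braid reduced_def)
qed

theorem bij_betw_perm_braid: "bij_betw (perm_braid n) {p. p permutes {1..n}} (garside_divisors n)"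
proof (rule bij_betw_imageI)
  show "inj_on (perm_braid n) {p. p permutes {1..n}}"
    by (rule inj_on_inverseI[where g = braid_perm]) (simp add: braid_perm_perm_braid)
  have "{p. p permutes {1..n}} \<subseteq> perm_of ` {w. reduced n w}" using ex_reduced by blast
  moreover have "perm_of ` {w. reduced n w} \<subseteq> {p. p permutes {1..n}}"
    using perm_of_permutes by (auto simp: reduced_def)
  ultimately have perms: "{p. p permutes {1..n}} = perm_of ` {w. reduced n w}" by (rule equalityI)
  show "perm_braid n ` {p. p permutes {1..n}} = garside_divisors n"
    unfolding garside_divisors_eq perms image_image
    by (intro image_cong HOL.refl) (simp add: perm_braid_perm_of)
qed

text \<open>A transposition crosses the gap between \<open>i\<close> and \<open>i + 1\<close> only
  if its letter is \<open>i\<close>.\<close>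

lemma perm_of_le_iff: "i \<notin> set w \<Longrightarrow> perm_of w j \<le> i \<longleftrightarrow> j \<le> i"
proof (induction w)
  case (Cons k w)
  moreover have "adj_transp k l \<le> i \<longleftrightarrow> l \<le> i" if "k \<noteq> i" for l
    using that by (auto simp: adj_transp_def transpose_def)
  ultimately show ?case by simp
qed simp

text \<open>The last letter \<open>i\<close> does not occur earlier, so the earlier letters keep
  \<open>i\<close> below the gap and \<open>i + 1\<close> above it: the last letter is appended at
  an ascent.\<close>

lemma distinct_imp_reduced: "distinct w \<Longrightarrow> set w \<subseteq> gens n \<Longrightarrow> reduced n w"
proof (induction w rule: rev_induct)
  case Nil
  then show ?case by (simp add: reduced_def)
next
  case (snoc i w)
  then have "perm_of w i \<le> i" "\<not> perm_of w (Suc i) \<le> i" using perm_of_le_iff[of i w] by simp_all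
  with snoc show ?case by (intro reduced_snoc_ascent) auto
qed

subsection \<open>Conjugacy of simple braids\<close>

abbreviation braid_class :: "nat \<Rightarrow> nat list \<Rightarrow> braid_word set set" where
  "braid_class n w \<equiv> conj_class (braid_group n) (positive_braid n w)"

text \<open>The conjugator is \<open>v\<close>, since v(uv) = (vu)v.\<close>

lemma braid_class_rotate:
  assumes "set u \<subseteq> gens n" "set v \<subseteq> gens n"
  shows "braid_class n (u @ v) = braid_class n (v @ u)"
proof -
  interpret group "braid_group n" by (rule group_braid_group)
  show ?thesis
    using assms by (intro conj_class_eqI[where g = "positive_braid n v"])
      (simp_all add: positive_braid_closed positive_braid_append m_assoc)
qed

lemma positive_braid_commute_letter:
  assumes "set u \<subseteq> gens n" "j \<in> gens n" "\<forall>i\<in>set u. i + 2 \<le> j"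
  shows "positive_braid n (u @ [j]) = positive_braid n (j # u)"
  using assms
proof (induction u)
  case (Cons i u)
  have "positive_braid n ((i # u) @ [j]) = positive_braid n ([i] @ u @ [j])" by simp
  also have "\<dots> = positive_braid n ([i] @ j # u)"
    using Cons by (intro positive_braid_eq_append_left) auto
  also have "\<dots> = positive_braid n ([i, j] @ u)" by simp
  also have "\<dots> = positive_braid n ([j, i] @ u)"
    using Cons.prems by (intro positive_braid_eq_append_right positive_braid_commute) auto
  finally show ?case by simp
qed simp

lemma positive_braid_commute_words:
  assumes "set u \<subseteq> gens n" "set v \<subseteq> gens n" "\<forall>i\<in>set u. \<forall>j\<in>set v. i + 2 \<le> j"
  shows "positive_braid n (u @ v) = positive_braid n (v @ u)"
  using assms
proof (induction v)
  case (Cons j v)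
  have "positive_braid n (u @ j # v) = positive_braid n ((u @ [j]) @ v)" by simp
  also have "\<dots> = positive_braid n ((j # u) @ v)"
    using Cons.prems by (intro positive_braid_eq_append_right positive_braid_commute_letter) auto
  also have "\<dots> = positive_braid n ([j] @ u @ v)" by simp
  also have "\<dots> = positive_braid n ([j] @ v @ u)"
    using Cons by (intro positive_braid_eq_append_left) auto
  finally show ?case by simp
qed simp

text \<open>The suffix \<open>r\<close> makes the induction work: rotating \<open>a k b r\<close> to \<open>b a k r\<close> moves the largest
  letter \<open>k\<close> of the prefix into it, since \<open>b\<close> commutes with \<open>r\<close>.\<close>

lemma braid_class_sort:
  assumes "distinct w" "set w \<subseteq> {1..<k}" "set r \<subseteq> {k..<n}" "set r \<subseteq> gens n" "k \<le> n"
  shows "braid_class n (w @ r) = braid_class n (filter (\<lambda>i. i \<in> set w) [1..<k] @ r)"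
  using assms
proof (induction k arbitrary: w r)
  case (Suc k)
  show ?case
  proof (cases "k \<in> set w")
    case False
    then have "set w \<subseteq> {1..<k}" using Suc.prems(2) by (fastforce simp: less_Suc_eq)
    moreover have "set r \<subseteq> {k..<n}" using Suc.prems(3) by auto
    moreover have "filter (\<lambda>i. i \<in> set w) [1..<Suc k] = filter (\<lambda>i. i \<in> set w) [1..<k]"
      using False by simp
    ultimately show ?thesis using Suc.IH[of w r] Suc.prems by simp
  next
    case True
    then obtain a b where w: "w = a @ k # b" by (auto dest: split_list)
    have k: "1 \<le> k" "k \<in> gens n" using True Suc.prems by auto
    have ab: "set a \<subseteq> {1..<k}" "set b \<subseteq> {1..<k}" "distinct (b @ a)"
      using Suc.prems(1,2) w by (fastforce simp: less_Suc_eq)+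
    then have ab': "set a \<subseteq> gens n" "set b \<subseteq> gens n" using Suc.prems(5) by auto
    have "positive_braid n (w @ r) = positive_braid n ((a @ [k]) @ b @ r)" using w by simp
    also have "\<dots> = positive_braid n ((a @ [k]) @ r @ b)"
      using ab ab' k Suc.prems(3,4)
      by (intro positive_braid_eq_append_left positive_braid_commute_words) fastforce+
    also have "\<dots> = positive_braid n ((a @ k # r) @ b)" by simp
    finally have "braid_class n (w @ r) = braid_class n ((a @ k # r) @ b)" by simp
    also have "\<dots> = braid_class n (b @ a @ k # r)"
      using ab' k Suc.prems(4) by (intro braid_class_rotate) auto
    also have "\<dots> = braid_class n ((b @ a) @ k # r)" by simp
    also have "\<dots> = braid_class n (filter (\<lambda>i. i \<in> set (b @ a)) [1..<k] @ k # r)"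
      using ab k Suc.prems(3,4,5) by (intro Suc.IH) auto
    also have "filter (\<lambda>i. i \<in> set (b @ a)) [1..<k] @ k # r = filter (\<lambda>i. i \<in> set w) [1..<Suc k] @ r"
      using k w by (auto intro!: filter_cong)
    finally show ?thesis .
  qed
qed simp

definition sorted_word :: "nat \<Rightarrow> nat set \<Rightarrow> nat list" where
  "sorted_word n S = filter (\<lambda>i. i \<in> S) [1..<n]"

lemma set_sorted_word: "S \<subseteq> gens n \<Longrightarrow> set (sorted_word n S) = S"
  by (auto simp: sorted_word_def)

lemma distinct_sorted_word: "distinct (sorted_word n S)"
  by (simp add: sorted_word_def)

lemma braid_class_distinct:
  "distinct w \<Longrightarrow> set w \<subseteq> gens n \<Longrightarrow> braid_class n w = braid_class n (sorted_word n (set w))"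
  using braid_class_sort[of w n "[]" n] by (simp add: sorted_word_def)

text \<open>The two words have the same permutation, because \<open>perm_of t\<close> carries the
  transposition of \<open>i\<close>, \<open>i + 1\<close> to that of \<open>j\<close>,
  \<open>j + 1\<close>. The first is reduced by an ascent, the second because it has the same
  length, and Matsumoto's theorem applies.\<close>

lemma positive_braid_conj_letter:
  assumes t: "reduced n t" and ij: "i \<in> gens n" "j \<in> gens n" "perm_of t i = j" "perm_of t (Suc i) = Suc j"
  shows "positive_braid n (t @ [i]) = positive_braid n (j # t)"
proof (rule matsumoto)
  have p: "perm_of t permutes {1..n}" using t by (simp add: reduced_def perm_of_permutes)
  show ti: "reduced n (t @ [i])" using t ij by (intro reduced_snoc_ascent) auto
  have "perm_of t (adj_transp i x) = adj_transp j (perm_of t x)" for x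
    using ij(3,4) inj_eq[OF permutes_inj[OF p], of x i] inj_eq[OF permutes_inj[OF p], of x "Suc i"]
    by (cases "x = i"; cases "x = Suc i") simp_all
  then show eq: "perm_of (t @ [i]) = perm_of (j # t)" by auto
  show "reduced n (j # t)"
    using ti eq ij(2) t unfolding reduced_def by (metis length_Cons length_append_singleton insert_subset list.simps(15))
qed

lemma positive_braid_conj_word:
  assumes t: "reduced n t"
    and u: "\<And>i. i \<in> set u \<Longrightarrow> i \<in> gens n \<and> perm_of t i \<in> gens n \<and> perm_of t (Suc i) = Suc (perm_of t i)"
  shows "positive_braid n (t @ u) = positive_braid n (map (perm_of t) u @ t)"
  using u
proof (induction u)
  case (Cons i u)
  have ts: "set t \<subseteq> gens n" using t by (simp add: reduced_def)
  have us: "set u \<subseteq> gens n" "set (map (perm_of t) u) \<subseteq> gens n" using Cons.prems by auto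
  have i: "i \<in> gens n" "perm_of t i \<in> gens n" "perm_of t (Suc i) = Suc (perm_of t i)"
    using Cons.prems by simp_all
  have "positive_braid n (t @ i # u) = positive_braid n ((t @ [i]) @ u)" by simp
  also have "\<dots> = positive_braid n ((perm_of t i # t) @ u)"
    using i us ts t by (intro positive_braid_eq_append_right positive_braid_conj_letter) auto
  also have "\<dots> = positive_braid n ([perm_of t i] @ t @ u)" by simp
  also have "\<dots> = positive_braid n ([perm_of t i] @ map (perm_of t) u @ t)"
    using Cons i us ts by (intro positive_braid_eq_append_left) auto
  finally show ?case by simp
qed simp

section \<open>Permutations of increasing words and their cycles\<close>

primrec block_start :: "nat set \<Rightarrow> nat \<Rightarrow> nat" where
  "block_start S 0 = 0"
| "block_start S (Suc i) = (if i \<in> S then block_start S i else Suc i)"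

text \<open>Think of \<open>i \<in> S\<close> as joining \<open>i\<close> to \<open>i + 1\<close>.
  The blocks are the maximal joined runs, and each is traversed upwards, its last point returning to
  the first.\<close>

definition block_cycle :: "nat set \<Rightarrow> nat \<Rightarrow> nat" where
  "block_cycle S i = (if i \<in> S then Suc i else block_start S i)"

lemma block_start_cong: "(\<And>j. j < i \<Longrightarrow> j \<in> S \<longleftrightarrow> j \<in> T) \<Longrightarrow> block_start S i = block_start T i"
  by (induction i) auto

text \<open>As \<open>n\<close> exceeds all of \<open>T\<close>, it ends a block and
  \<open>n + 1\<close> is a block by itself. Exchanging the two before \<open>block_cycle T\<close>
  inserts \<open>n + 1\<close> between \<open>n\<close> and the start of that block.\<close>

lemma block_cycle_insert:
  assumes "T \<subseteq> {..<n}"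
  shows "block_cycle (insert n T) = block_cycle T \<circ> adj_transp n"
proof
  fix i
  have n: "n \<notin> T" "Suc n \<notin> T" using assms by auto
  have eq: "block_start (insert n T) i = block_start T i" if "i \<le> n" for i
    using that by (intro block_start_cong) auto
  consider "i < n" | "i = n" | "i = Suc n" | m where "i = Suc m" "n < m"
    by (metis Suc_lessE linorder_neqE_nat not_less_eq)
  then show "block_cycle (insert n T) i = (block_cycle T \<circ> adj_transp n) i"
    using n eq assms by cases (auto simp: block_cycle_def)
qed

lemma perm_of_sorted_word: "perm_of (sorted_word n S) = block_cycle (S \<inter> gens n)"
proof (induction n)
  case 0
  have "block_start {} i = i" for i by (cases i) auto
  then show ?case by (auto simp: sorted_word_def block_cycle_def)
next
  case (Suc n)
  show ?case
  proof (cases "n \<in> S \<and> 1 \<le> n")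
    case True
    then have "S \<inter> gens (Suc n) = insert n (S \<inter> gens n)" by auto
    moreover have "sorted_word (Suc n) S = sorted_word n S @ [n]"
      using True by (simp add: sorted_word_def)
    moreover have "S \<inter> gens n \<subseteq> {..<n}" by auto
    ultimately show ?thesis using Suc.IH by (simp add: block_cycle_insert)
  next
    case False
    then have "S \<inter> gens (Suc n) = S \<inter> gens n" by (auto simp: less_Suc_eq)
    moreover have "sorted_word (Suc n) S = sorted_word n S"
      using False by (auto simp: sorted_word_def)
    ultimately show ?thesis using Suc.IH by simp
  qed
qed

lemma perm_of_sorted_word': "S \<subseteq> gens n \<Longrightarrow> perm_of (sorted_word n S) = block_cycle S"
  by (simp add: perm_of_sorted_word Int_absorb2)

lemma block_cycle_permutes:
  assumes "S \<subseteq> gens n"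
  shows "block_cycle S permutes {1..n}"
proof -
  have "set (sorted_word n S) \<subseteq> gens n" by (auto simp: sorted_word_def)
  from perm_of_permutes[OF this] show ?thesis using perm_of_sorted_word'[OF assms] by simp
qed

lemma block_start_le: "block_start S i \<le> i"
  by (induction i) auto

lemma block_start_idem [simp]: "block_start S (block_start S i) = block_start S i"
  by (induction i) auto

lemma block_start_cycle [simp]: "block_start S (block_cycle S i) = block_start S i"
  by (simp add: block_cycle_def)

lemma block_start_cycle_funpow [simp]: "block_start S ((block_cycle S ^^ m) i) = block_start S i"
  by (induction m) simp_all

lemma block_cycle_reaches_from_start: "\<exists>m. (block_cycle S ^^ m) (block_start S i) = i"
proof (induction i)
  case 0
  then show ?case by (intro exI[of _ 0]) simp
next
  case (Suc i)
  show ?case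
  proof (cases "i \<in> S")
    case True
    obtain m where "(block_cycle S ^^ m) (block_start S i) = i" using Suc by blast
    then have "(block_cycle S ^^ Suc m) (block_start S (Suc i)) = Suc i"
      using True by (simp add: block_cycle_def)
    then show ?thesis by blast
  next
    case False
    then show ?thesis by (intro exI[of _ 0]) simp
  qed
qed

lemma block_cycle_reaches_start:
  assumes "S \<subseteq> gens n"
  shows "\<exists>m. (block_cycle S ^^ m) i = block_start S i"
proof (induction "n - i" arbitrary: i rule: less_induct)
  case less
  show ?case
  proof (cases "i \<in> S")
    case True
    then have "i < n" using assms by auto
    then have "n - Suc i < n - i" by simp
    from less[OF this] obtain m where "(block_cycle S ^^ m) (Suc i) = block_start S (Suc i)" by blast
    then have "(block_cycle S ^^ Suc m) i = block_start S i"
      using True by (simp add: funpow_Suc_right block_cycle_def del: funpow.simps)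
    then show ?thesis by blast
  next
    case False
    then show ?thesis by (intro exI[of _ "Suc 0"]) (simp add: block_cycle_def)
  qed
qed

text \<open>From \<open>i\<close> one reaches the start of its block and from there
  \<open>j\<close>. Blocks are thus the orbits of the permutation, a description that conjugation
  transports.\<close>

lemma block_start_eq_iff:
  assumes "S \<subseteq> gens n"
  shows "block_start S i = block_start S j \<longleftrightarrow> (\<exists>m. j = (block_cycle S ^^ m) i)"
proof
  assume eq: "block_start S i = block_start S j"
  obtain l where "(block_cycle S ^^ l) i = block_start S i"
    using block_cycle_reaches_start[OF assms] by blast
  moreover obtain m where "(block_cycle S ^^ m) (block_start S j) = j"
    using block_cycle_reaches_from_start by blast
  ultimately have "j = (block_cycle S ^^ (m + l)) i" using eq by (simp add: funpow_add)
  then show "\<exists>m. j = (block_cycle S ^^ m) i" by blast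
qed auto

text \<open>A conjugator maps cycles to cycles but may shift them. The correction by a power of
  \<open>block_cycle T\<close>, one exponent for each cycle, makes starts go to starts; then last
  points go to last points, and the remaining points are exactly \<open>S\<close> and
  \<open>T\<close>.\<close>

lemma conjugator_matching_blocks:
  assumes S: "S \<subseteq> gens n" and T: "T \<subseteq> gens n" and g: "g permutes {1..n}"
    and conj: "g \<circ> block_cycle S = block_cycle T \<circ> g"
  shows "\<exists>h. h permutes {1..n} \<and> (\<forall>i\<in>S. h (Suc i) = Suc (h i)) \<and> h ` S = T"
proof -
  let ?a = "block_cycle S" and ?b = "block_cycle T"
  have b: "?b ^^ m permutes {1..n}" for m
    using block_cycle_permutes[OF T] by (rule permutes_funpow)
  have conj1: "g (?a i) = ?b (g i)" for i
    using conj by (simp add: fun_eq_iff)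
  have conjm: "g ((?a ^^ m) i) = (?b ^^ m) (g i)" for i m
    by (induction m) (simp_all add: conj1)
  have same_block: "block_start S i = block_start S j \<longleftrightarrow> block_start T (g i) = block_start T (g j)" for i j
    unfolding block_start_eq_iff[OF S] block_start_eq_iff[OF T]
    using inj_eq[OF permutes_inj[OF g]] by (simp flip: conjm)
  obtain m where m: "(?b ^^ m i) i = block_start T i" for i
    using block_cycle_reaches_start[OF T] by metis
  \<comment> \<open>The exponent depends on the block of \<open>i\<close> alone. Hence
    \<open>h\<close> still intertwines the two permutations, and it is injective on each block;
    distinct blocks have distinct images by \<open>same_block\<close>.\<close>
  define h where "h i = (?b ^^ m (g (block_start S i))) (g i)" for i
  have start_h: "block_start T (h i) = block_start T (g i)" for i
    by (simp add: h_def)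
  have h_start: "h (block_start S i) = block_start T (h i)" for i
  proof -
    have "h (block_start S i) = block_start T (g (block_start S i))" by (simp add: h_def m)
    also have "\<dots> = block_start T (g i)" using same_block[of "block_start S i" i] by simp
    finally show ?thesis by (simp add: start_h)
  qed
  have h_cycle: "h (?a i) = ?b (h i)" for i
    by (simp add: h_def conj1 funpow_swap1)
  have inj: "inj h"
  proof (rule injI)
    fix i j assume eq: "h i = h j"
    then have "block_start S i = block_start S j" using same_block start_h by metis
    then have "g i = g j" using eq inj_eq[OF permutes_inj[OF b]] by (simp add: h_def)
    then show "i = j" using inj_eq[OF permutes_inj[OF g]] by simp
  qed
  have h: "h permutes {1..n}"
  proof (rule inj_imp_permutes)
    show "inj_on h {1..n}" using inj by (rule inj_on_subset) simp
    show "h i \<in> {1..n}" if "i \<in> {1..n}" for i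
      using that by (simp only: h_def permutes_in_image[OF b] permutes_in_image[OF g])
    show "h i = i" if "i \<notin> {1..n}" for i
      using that by (simp only: h_def permutes_not_in[OF g] permutes_not_in[OF b] not_False_eq_True)
  qed simp
  \<comment> \<open>If \<open>h i\<close> ended its block, \<open>h (Suc i)\<close> would be the
    start of that block, which is also the image of \<open>block_start S i\<close>; injectivity then
    equates \<open>Suc i\<close> with a point not above \<open>i\<close>.\<close>
  have mem: "h i \<in> T" if "i \<in> S" for i
  proof (rule ccontr)
    assume "h i \<notin> T"
    then have "h (Suc i) = h (block_start S i)"
      using h_cycle[of i] that by (simp add: block_cycle_def h_start)
    then show False using inj_eq[OF inj] block_start_le[of S i] by simp
  qed
  have "T \<subseteq> h ` S"
  proof
    fix j assume j: "j \<in> T"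
    obtain i where i: "j = h i" using permutes_surj[OF h] by blast
    have "i \<in> S"
    proof (rule ccontr)
      assume "i \<notin> S"
      then have "Suc j = block_start T j"
        using h_cycle[of i] i j by (simp add: block_cycle_def h_start)
      then show False using block_start_le[of T j] by simp
    qed
    with i show "j \<in> h ` S" by blast
  qed
  moreover have "h (Suc i) = Suc (h i)" if "i \<in> S" for i
    using h_cycle[of i] mem[OF that] that by (simp add: block_cycle_def)
  ultimately show ?thesis using h mem by blast
qed

lemma braid_class_sorted_word_eq:
  assumes S: "S \<subseteq> gens n" and T: "T \<subseteq> gens n" and g: "g permutes {1..n}"
    and conj: "g \<circ> block_cycle S = block_cycle T \<circ> g"
  shows "braid_class n (sorted_word n S) = braid_class n (sorted_word n T)"
proof -
  obtain h where h: "h permutes {1..n}" "\<forall>i\<in>S. h (Suc i) = Suc (h i)" "h ` S = T"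
    using conjugator_matching_blocks[OF assms] by blast
  obtain t where t: "reduced n t" "perm_of t = h" using ex_reduced[OF h(1)] by blast
  let ?u = "sorted_word n S"
  have u: "set ?u = S" "set (map h ?u) = T" using set_sorted_word[OF S] h(3) by simp_all
  have "positive_braid n (t @ ?u) = positive_braid n (map h ?u @ t)"
    using positive_braid_conj_word[OF t(1), of ?u] h(2,3) S T u(1) t(2) by blast
  then have "positive_braid n t \<otimes>\<^bsub>braid_group n\<^esub> positive_braid n ?u
      = positive_braid n (map h ?u) \<otimes>\<^bsub>braid_group n\<^esub> positive_braid n t"
    using S T t u by (simp add: positive_braid_append reduced_def del: set_map)
  then have "braid_class n ?u = braid_class n (map h ?u)"
    using S T t u by (intro group.conj_class_eqI[OF group_braid_group, where g = "positive_braid n t"])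
      (simp_all add: positive_braid_closed reduced_def del: set_map)
  \<comment> \<open>The word \<open>map h ?u\<close> has distinct letters with set \<open>T\<close>
    but need not be increasing, so it is sorted within its conjugacy class.\<close>
  also have "\<dots> = braid_class n (sorted_word n T)"
  proof -
    have "distinct (map h ?u)"
      using inj_on_subset[OF permutes_inj[OF h(1)] subset_UNIV]
      by (simp add: distinct_map distinct_sorted_word)
    then show ?thesis using braid_class_distinct[of "map h ?u" n] T u by (simp del: set_map)
  qed
  finally show ?thesis .
qed

text \<open>The conjugate \<open>q\<close> is normalised point by point. If
  \<open>q k \<le> k\<close>, the current block closes at \<open>k\<close>; otherwise a relabelling
  makes \<open>q k = k + 1\<close> and \<open>k\<close> joins \<open>S\<close>.\<close>

lemma conjugate_to_block_cycle:
  assumes p: "p permutes {1..n}"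
  shows "\<exists>S g. S \<subseteq> gens n \<and> g permutes {1..n} \<and> g \<circ> p = block_cycle S \<circ> g"
proof -
  \<comment> \<open>The value \<open>q k\<close> is taken by \<open>block_cycle S\<close> at some
    \<open>j \<le> k\<close>; if \<open>j < k\<close>, then \<open>q\<close> would take it at both
    \<open>j\<close> and \<open>k\<close>.\<close>
  have closes: "q k = block_cycle S k"
    if q: "q permutes {1..n}" and S: "S \<subseteq> gens k" and agree: "\<And>i. i < k \<Longrightarrow> q i = block_cycle S i"
      and le: "q k \<le> k" for q k S
  proof -
    have a: "block_cycle S permutes {1..k}" using S by (rule block_cycle_permutes)
    obtain j where j: "q k = block_cycle S j" using permutes_surj[OF a] by blast
    then have "j \<le> k" using le permutes_le_iff[OF a] by simp
    moreover have "\<not> j < k" using agree[of j] j inj_eq[OF permutes_inj[OF q], of j k] by auto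
    ultimately show ?thesis using j by simp
  qed
  have partial: "\<exists>S q g. S \<subseteq> gens k \<and> q permutes {1..n} \<and> g permutes {1..n} \<and> g \<circ> p = q \<circ> g
      \<and> (\<forall>i<k. q i = block_cycle S i)" if "k \<le> n" for k
    using that
  proof (induction k)
    case 0
    show ?case using p permutes_id by (intro exI[of _ "{}"] exI[of _ p] exI[of _ id]) simp
  next
    case (Suc k)
    from Suc.prems have "k \<le> n" by simp
    from Suc.IH[OF this] obtain S q g where S: "S \<subseteq> gens k" and q: "q permutes {1..n}"
      and g: "g permutes {1..n}" and conj: "g \<circ> p = q \<circ> g"
      and agree: "\<And>i. i < k \<Longrightarrow> q i = block_cycle S i" by blast
    show ?case
    proof (cases "q k \<le> k")
      case True
      have "S \<subseteq> gens (Suc k)" using S by auto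
      moreover have "\<forall>i<Suc k. q i = block_cycle S i"
        using agree closes[OF q S agree True] by (auto simp: less_Suc_eq)
      ultimately show ?thesis using q g conj by blast
    next
      case False
      \<comment> \<open>Both transposed points exceed \<open>k\<close>, while the points below
        \<open>k\<close> and their images under \<open>q\<close> do not. So conjugation by
        \<open>?t\<close> changes nothing below \<open>k\<close> and sends \<open>k\<close> to
        \<open>k + 1\<close>.\<close>
      let ?t = "transpose (Suc k) (q k)"
      have k: "1 \<le> k" using False permutes_not_in[OF q, of 0] by (cases k) auto
      have t: "?t permutes {1..n}"
        using Suc.prems permutes_le_iff[OF q, of k] False by (intro permutes_swap_id) auto
      have "insert k S \<subseteq> gens (Suc k)" using S k by auto
      moreover have "?t \<circ> q \<circ> ?t permutes {1..n}" "?t \<circ> g permutes {1..n}"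
        using t q g by (auto intro!: permutes_compose simp flip: comp_assoc)
      moreover have "?t \<circ> g \<circ> p = ?t \<circ> q \<circ> ?t \<circ> (?t \<circ> g)"
        using conj by (simp add: fun_eq_iff)
      moreover have "(?t \<circ> q \<circ> ?t) i = block_cycle (insert k S) i" if "i < Suc k" for i
      proof (cases "i = k")
        case True
        then show ?thesis using False by (simp add: block_cycle_def)
      next
        case i: False
        with that have "i < k" by simp
        then have "q i \<le> k"
          using agree permutes_le_iff[OF block_cycle_permutes[OF S], of i] by simp
        moreover have "block_start (insert k S) i = block_start S i"
          using \<open>i < k\<close> by (intro block_start_cong) auto
        ultimately show ?thesis using \<open>i < k\<close> agree[of i] False i
          by (simp add: block_cycle_def transpose_def)
      qed
      ultimately show ?thesis by blast
    qed
  qed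
  obtain S q g where S: "S \<subseteq> gens n" and q: "q permutes {1..n}" and g: "g permutes {1..n}"
    and conj: "g \<circ> p = q \<circ> g" and agree: "\<And>i. i < n \<Longrightarrow> q i = block_cycle S i"
    using partial[OF order_refl] by blast
  have "q i = block_cycle S i" for i
  proof -
    consider "i < n" | "i = n" | "n < i" by linarith
    then show ?thesis
    proof cases
      case 2
      then show ?thesis using closes[OF q S agree] permutes_le_iff[OF q, of n] by simp
    next
      case 3
      then show ?thesis
        using permutes_not_in[OF q] permutes_not_in[OF block_cycle_permutes[OF S]] by auto
    qed (rule agree)
  qed
  then have "q = block_cycle S" by blast
  with S g conj show ?thesis by blast
qed

section \<open>The maps on conjugacy classes\<close>

lemma positive_braids_subset: "positive_braids n \<subseteq> carrier (braid_group n)"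
  using positive_braid_closed by (auto simp: positive_braids_eq)

lemma garside_divisors_subset: "garside_divisors n \<subseteq> positive_braids n"
  by (auto simp: garside_divisors_def)

lemma simple_braids_subset: "simple_braids n \<subseteq> garside_divisors n"
  unfolding simple_braids_eq garside_divisors_eq using distinct_imp_reduced by blast

text \<open>Injectivity of \<pi>': sorting both braids leaves two increasing words, and a conjugator
  of their permutations lifts to one of the braids.\<close>

lemma simple_braids_conjI:
  assumes "\<beta> \<in> simple_braids n" "\<gamma> \<in> simple_braids n"
    and "conj_class (sym_group n) (braid_perm \<beta>) = conj_class (sym_group n) (braid_perm \<gamma>)"
  shows "conj_class (braid_group n) \<beta> = conj_class (braid_group n) \<gamma>"
proof -
  have sorted: "\<exists>S\<subseteq>gens n. conj_class (braid_group n) \<beta> = braid_class n (sorted_word n S)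
      \<and> conj_class (sym_group n) (braid_perm \<beta>) = conj_class (sym_group n) (block_cycle S)"
    if \<beta>: "\<beta> \<in> simple_braids n" for \<beta>
  proof -
    obtain w where w: "distinct w" "set w \<subseteq> gens n" "\<beta> = positive_braid n w"
      using \<beta> unfolding simple_braids_eq by blast
    let ?s = "sorted_word n (set w)"
    have s: "set ?s \<subseteq> gens n" unfolding set_sorted_word[OF w(2)] by (rule w(2))
    have eq: "conj_class (braid_group n) \<beta> = braid_class n ?s"
      unfolding w(3) by (rule braid_class_distinct[OF w(1,2)])
    moreover have "conj_class (sym_group n) (braid_perm \<beta>)
        = conj_class (sym_group n) (braid_perm (positive_braid n ?s))"
    proof (rule hom_conj_class_eq[OF group_braid_group sym_group_is_group braid_perm_hom _ _ eq])
      show "\<beta> \<in> carrier (braid_group n)" "positive_braid n ?s \<in> carrier (braid_group n)"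
        unfolding w(3) by (rule positive_braid_closed[OF w(2)], rule positive_braid_closed[OF s])
    qed
    moreover have "braid_perm (positive_braid n ?s) = block_cycle (set w)"
      using braid_perm_positive_braid[OF s] perm_of_sorted_word'[OF w(2)] by simp
    ultimately show ?thesis using w(2) by (intro exI[of _ "set w"]) simp
  qed
  obtain S where S: "S \<subseteq> gens n" "conj_class (braid_group n) \<beta> = braid_class n (sorted_word n S)"
    "conj_class (sym_group n) (braid_perm \<beta>) = conj_class (sym_group n) (block_cycle S)"
    using sorted[OF assms(1)] by blast
  obtain T where T: "T \<subseteq> gens n" "conj_class (braid_group n) \<gamma> = braid_class n (sorted_word n T)"
    "conj_class (sym_group n) (braid_perm \<gamma>) = conj_class (sym_group n) (block_cycle T)"
    using sorted[OF assms(2)] by blast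
  have "conj_class (sym_group n) (block_cycle S) = conj_class (sym_group n) (block_cycle T)"
    using S(3) T(3) assms(3) by simp
  moreover have "block_cycle S \<in> carrier (sym_group n)" "block_cycle T \<in> carrier (sym_group n)"
    using block_cycle_permutes S(1) T(1) by (simp_all only: sym_group_carrier)
  ultimately obtain g where "g \<in> carrier (sym_group n)"
    "g \<otimes>\<^bsub>sym_group n\<^esub> block_cycle S = block_cycle T \<otimes>\<^bsub>sym_group n\<^esub> g"
    by (rule group.conj_class_eqE[OF sym_group_is_group])
  then have "braid_class n (sorted_word n S) = braid_class n (sorted_word n T)"
    by (intro braid_class_sorted_word_eq[OF S(1) T(1)]) (simp_all only: sym_group_carrier sym_group_mult)
  then show ?thesis using S(2) T(2) by simp
qed

lemma conj_to_simple_braid: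
  assumes "p \<in> carrier (sym_group n)"
  shows "\<exists>\<beta>\<in>simple_braids n. conj_class (sym_group n) p = conj_class (sym_group n) (braid_perm \<beta>)"
proof -
  have "p permutes {1..n}" using assms by (simp only: sym_group_carrier)
  then obtain S g where S: "S \<subseteq> gens n" and g: "g permutes {1..n}" "g \<circ> p = block_cycle S \<circ> g"
    using conjugate_to_block_cycle by blast
  let ?s = "sorted_word n S"
  have "braid_perm (positive_braid n ?s) = block_cycle S"
    using braid_perm_positive_braid[of ?s n] set_sorted_word[OF S] perm_of_sorted_word'[OF S] S by simp
  moreover have "positive_braid n ?s \<in> simple_braids n"
    unfolding simple_braids_eq using set_sorted_word[OF S] distinct_sorted_word S by blast
  moreover have "conj_class (sym_group n) p = conj_class (sym_group n) (block_cycle S)"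
    using g assms block_cycle_permutes[OF S]
    by (intro group.conj_class_eqI[OF sym_group_is_group, where g = g])
      (simp_all only: sym_group_carrier sym_group_mult)
  ultimately show ?thesis by metis
qed

lemma image_funcset:
  assumes "\<And>a. a \<in> A \<Longrightarrow> \<exists>b\<in>B. f (F a) = G b"
  shows "f \<in> F ` A \<rightarrow> G ` B"
  using assms by blast

theorem corollary1p11:
  fixes n :: nat
  assumes "n \<ge> 1"
  shows
    "simple_braids n \<subseteq> garside_divisors n \<and>
     garside_divisors n \<subseteq> positive_braids n \<and>
     positive_braids n \<subseteq> carrier (braid_group n) \<and>
     braid_perm \<in> hom (braid_group n) (sym_group n) \<and>
     perm_braid n \<in> carrier (sym_group n) \<rightarrow> garside_divisors n \<and>
     conj_class (braid_group n) \<in>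
       simple_braids n \<rightarrow> conj_classes_meeting (braid_group n) (simple_braids n) \<and>
     conj_class (braid_group n) \<in>
       garside_divisors n \<rightarrow> conj_classes_meeting (braid_group n) (garside_divisors n) \<and>
     conj_class (braid_group n) \<in>
       positive_braids n \<rightarrow> conj_classes_meeting (braid_group n) (positive_braids n) \<and>
     conj_class (braid_group n) \<in>
       carrier (braid_group n) \<rightarrow>
       conj_classes_meeting (braid_group n) (carrier (braid_group n)) \<and>
     conj_class (sym_group n) \<in>
       carrier (sym_group n) \<rightarrow>
       conj_classes_meeting (sym_group n) (carrier (sym_group n)) \<and>
     simple_to_div n \<in>
       conj_classes_meeting (braid_group n) (simple_braids n) \<rightarrow>
       conj_classes_meeting (braid_group n) (garside_divisors n) \<and>
     div_to_positive n \<in>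
       conj_classes_meeting (braid_group n) (garside_divisors n) \<rightarrow>
       conj_classes_meeting (braid_group n) (positive_braids n) \<and>
     positive_to_braid n \<in>
       conj_classes_meeting (braid_group n) (positive_braids n) \<rightarrow>
       conj_classes_meeting (braid_group n) (carrier (braid_group n)) \<and>
     braid_to_perm n \<in>
       conj_classes_meeting (braid_group n) (carrier (braid_group n)) \<rightarrow>
       conj_classes_meeting (sym_group n) (carrier (sym_group n)) \<and>
     (\<forall>\<beta>\<in>simple_braids n.
        simple_to_div n (conj_class (braid_group n) \<beta>) = conj_class (braid_group n) \<beta>) \<and>
     (\<forall>\<beta>\<in>garside_divisors n.
        div_to_positive n (conj_class (braid_group n) \<beta>) = conj_class (braid_group n) \<beta>) \<and>
     (\<forall>\<beta>\<in>positive_braids n.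
        positive_to_braid n (conj_class (braid_group n) \<beta>) = conj_class (braid_group n) \<beta>) \<and>
     (\<forall>\<beta>\<in>carrier (braid_group n).
        braid_to_perm n (conj_class (braid_group n) \<beta>) = conj_class (sym_group n) (braid_perm \<beta>)) \<and>
     (\<forall>p\<in>carrier (sym_group n). braid_perm (perm_braid n p) = p) \<and>
     bij_betw (perm_braid n) (carrier (sym_group n)) (garside_divisors n) \<and>
     bij_betw (simple_to_perm n)
       (conj_classes_meeting (braid_group n) (simple_braids n))
       (conj_classes_meeting (sym_group n) (carrier (sym_group n)))"
proof -
  let ?B = "braid_group n" and ?S = "sym_group n"
  have subsets: "simple_braids n \<subseteq> garside_divisors n" "garside_divisors n \<subseteq> positive_braids n"
    "positive_braids n \<subseteq> carrier ?B"
    by (rule simple_braids_subset garside_divisors_subset positive_braids_subset)+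
  then have carrier: "simple_braids n \<subseteq> carrier ?B" "garside_divisors n \<subseteq> carrier ?B" by auto
  note B = group.conj_classes_meeting_eq[OF group_braid_group]
  note S = group.conj_classes_meeting_eq[OF sym_group_is_group]
  note classes = B[OF carrier(1)] B[OF carrier(2)] B[OF subsets(3)] B[OF order_refl] S[OF order_refl]
  have perm_closed: "braid_perm \<beta> \<in> carrier ?S" if "\<beta> \<in> carrier ?B" for \<beta>
    using hom_in_carrier[OF braid_perm_hom that] .
  have ind_S: "simple_to_div n (conj_class ?B \<beta>) = conj_class ?B \<beta>" if "\<beta> \<in> simple_braids n" for \<beta>
    unfolding simple_to_div_def using induced_map_class[OF group_braid_group carrier(1) that, of ?B id] by simp
  have ind_D: "div_to_positive n (conj_class ?B \<beta>) = conj_class ?B \<beta>" if "\<beta> \<in> garside_divisors n" for \<beta>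
    unfolding div_to_positive_def using induced_map_class[OF group_braid_group carrier(2) that, of ?B id] by simp
  have ind_P: "positive_to_braid n (conj_class ?B \<beta>) = conj_class ?B \<beta>" if "\<beta> \<in> positive_braids n" for \<beta>
    unfolding positive_to_braid_def using induced_map_class[OF group_braid_group subsets(3) that, of ?B id] by simp
  \<comment> \<open>Independence of the representative is immediate for the three inclusions above;
    here it comes from \<open>braid_perm\<close> being a homomorphism.\<close>
  have ind_B: "braid_to_perm n (conj_class ?B \<beta>) = conj_class ?S (braid_perm \<beta>)"
    if "\<beta> \<in> carrier ?B" for \<beta>
    unfolding braid_to_perm_def
    using that hom_conj_class_eq[OF group_braid_group sym_group_is_group braid_perm_hom that]
    by (intro induced_map_class[OF group_braid_group order_refl that])
  have ind: "simple_to_perm n (conj_class ?B \<beta>) = conj_class ?S (braid_perm \<beta>)"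
    if "\<beta> \<in> simple_braids n" for \<beta>
  proof -
    have "\<beta> \<in> garside_divisors n" "\<beta> \<in> positive_braids n" "\<beta> \<in> carrier ?B" using that subsets by auto
    then show ?thesis
      using that by (simp add: simple_to_perm_def ind_S ind_D ind_P ind_B)
  qed
  have sym_carrier: "carrier ?S = {p. p permutes {1..n}}"
    by (simp only: sym_group_carrier set_eq_iff mem_Collect_eq simp_thms)
  have bij_s: "bij_betw (perm_braid n) (carrier ?S) (garside_divisors n)"
    unfolding sym_carrier by (rule bij_betw_perm_braid)
  have perm_section: "braid_perm (perm_braid n p) = p" if "p \<in> carrier ?S" for p
    using that braid_perm_perm_braid by (simp only: sym_group_carrier)
  have bij_\<pi>: "bij_betw (simple_to_perm n) (conj_class ?B ` simple_braids n) (conj_class ?S ` carrier ?S)"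
  proof (rule bij_betw_imageI)
    show "inj_on (simple_to_perm n) (conj_class ?B ` simple_braids n)"
    proof (rule inj_onI)
      fix C D assume "C \<in> conj_class ?B ` simple_braids n" "D \<in> conj_class ?B ` simple_braids n"
        and eq: "simple_to_perm n C = simple_to_perm n D"
      then obtain \<beta> \<gamma> where simple: "\<beta> \<in> simple_braids n" "\<gamma> \<in> simple_braids n"
        and CD: "C = conj_class ?B \<beta>" "D = conj_class ?B \<gamma>" by blast
      show "C = D"
        using eq unfolding CD ind[OF simple(1)] ind[OF simple(2)] by (rule simple_braids_conjI[OF simple])
    qed
    have "simple_to_perm n ` conj_class ?B ` simple_braids n
        = (\<lambda>\<beta>. conj_class ?S (braid_perm \<beta>)) ` simple_braids n"
      unfolding image_image by (intro image_cong HOL.refl) (rule ind)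
    also have "\<dots> = conj_class ?S ` carrier ?S"
    proof (intro equalityI subsetI)
      fix C assume "C \<in> (\<lambda>\<beta>. conj_class ?S (braid_perm \<beta>)) ` simple_braids n"
      then show "C \<in> conj_class ?S ` carrier ?S" using perm_closed carrier(1) by blast
    next
      fix C assume "C \<in> conj_class ?S ` carrier ?S"
      then show "C \<in> (\<lambda>\<beta>. conj_class ?S (braid_perm \<beta>)) ` simple_braids n"
        using conj_to_simple_braid by blast
    qed
    finally show "simple_to_perm n ` conj_class ?B ` simple_braids n = conj_class ?S ` carrier ?S" .
  qed
  have maps:
    "simple_to_div n \<in> conj_class ?B ` simple_braids n \<rightarrow> conj_class ?B ` garside_divisors n"
    "div_to_positive n \<in> conj_class ?B ` garside_divisors n \<rightarrow> conj_class ?B ` positive_braids n"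
    "positive_to_braid n \<in> conj_class ?B ` positive_braids n \<rightarrow> conj_class ?B ` carrier ?B"
    "braid_to_perm n \<in> conj_class ?B ` carrier ?B \<rightarrow> conj_class ?S ` carrier ?S"
    by (rule image_funcset; use subsets perm_closed ind_S ind_D ind_P ind_B in blast)+
  have to_class: "conj_class ?B \<in> A \<rightarrow> conj_class ?B ` A" "conj_class ?S \<in> P \<rightarrow> conj_class ?S ` P" for A P
    by (simp_all add: Pi_I)
  show ?thesis
    unfolding classes
    by (intro conjI ballI subsets braid_perm_hom bij_betw_imp_funcset[OF bij_s] to_class maps
        ind_S ind_D ind_P ind_B perm_section bij_s bij_\<pi>)
qed

end
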